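(* Let $m(t),n(t)\colon\mathbb{Z}_{>0}\to\mathbb{Z}_{>0}$ be functions satisfying $m(t),n(t)\to\infty$ as $t\to\infty$, and write $m=m(t)$, $n=n(t)$. Then, as $t\to\infty$: (a) If $\frac{n^2+n}{2}<m$ and $m=\Theta(n^2)$, then $\log|\mathcal{D}_n^m|\sim\log\left|\mathcal{D}_n^{\frac{n^2+n}{2}}\right|$. (b) If $\log m=\omega(\log n)$, then $\log|\mathcal{D}_n^m|\sim\log\binom{m}{\frac{n^2+n}{2}}$. Moreover, when the positive integer $n$ is fixed, $|\mathcal{D}_n^m|$ is a polynomial in $m$, and as $m\to\infty$ $$|\mathcal{D}_n^m|=\frac{\left(\frac{n^2+n}{2}\right)!}{1!\,2!\cdots n!}\binom{m}{\frac{n^2+n}{2}}+\frac{\left(\frac{n^2+n}{2}\right)!}{1!\,2!\cdots n!}\left(1+\frac{(n-1)(n-2)}{4}\right)\binom{m}{\frac{n^2+n}{2}-1}+O\left(m^{\frac{n^2+n}{2}-2}\right).$$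
   Context: For a polynomial $P\in\mathbb{C}[x]$ of degree exactly $n$ and an $m$-tuple $\Lambda=(\lambda_1,\ldots,\lambda_m)$ of distinct complex numbers, the dope matrix $D_P(\Lambda)$ is the $m\times(n+1)$ matrix $(c_{ij})$, with $i\in\{1,\ldots,m\}$ and $j\in\{0,1,\ldots,n\}$, where $c_{ij}=1$ if $P^{(j)}(\lambda_i)=0$ and $c_{ij}=0$ otherwise. $\mathcal{D}_n^m$ denotes the set of all $m\times(n+1)$ dope matrices, i.e. all matrices $D_P(\Lambda)$ with $\deg P=n$ and $\Lambda$ any $m$-tuple of distinct complex numbers. Asymptotic notation for functions $f,g$ of $t$, as $t\to\infty$: $f=\Theta(g)$ means that for some positive constants $K,K'$ one has $K|g|\le|f|\le K'|g|$ for all sufficiently large $t$; $f=\omega(g)$ means that for every constant $M$ one has $|f|\ge M|g|$ for all sufficiently large $t$; $f\sim g$ means $f/g\to1$. In the fixed-$n$ part, the implied constant in $O(\cdot)$ may depend on $n$. *)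

theory Defs
  imports
    "HOL-Computational_Algebra.Polynomial"
    "HOL-Library.Landau_Symbols"
    "Jordan_Normal_Form.Matrix"
begin

text \<open>
  Rows are indexed from 0, so row \<open>i\<close> belongs to the entry \<open>\<Lambda> ! i\<close>, the point
  $\lambda_{i+1}$ in the usual numbering; column \<open>j\<close> belongs to the \<open>j\<close>-th derivative,
  the \<open>0\<close>-th one being \<open>P\<close> itself.
\<close>

definition dope_matrix :: "complex poly \<Rightarrow> complex list \<Rightarrow> nat mat" where
  "dope_matrix P \<Lambda> =
     mat (length \<Lambda>) (degree P + 1)
       (\<lambda>(i, j). if poly ((pderiv ^^ j) P) (\<Lambda> ! i) = 0 then 1 else 0)"

text \<open>
  The condition \<open>P \<noteq> 0\<close> only matters for \<open>n = 0\<close>: the library sets \<open>degree 0 = 0\<close>.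
\<close>

definition dope_matrices :: "nat \<Rightarrow> nat \<Rightarrow> nat mat set" where
  "dope_matrices m n =
     {dope_matrix P \<Lambda> | P \<Lambda>. P \<noteq> 0 \<and> degree P = n \<and> length \<Lambda> = m \<and> distinct \<Lambda>}"

text \<open>
  Since \<open>card\<close> is \<open>0\<close> on infinite sets, the following makes sure that
  \<open>card (dope_matrices m n)\<close> is the actual number of dope matrices.
\<close>

lemma finite_dope_matrices: "finite (dope_matrices m n)"
proof -
  let ?I = "{..<m} \<times> {..<n + 1}"
  let ?F = "?I \<rightarrow>\<^sub>E {0, 1 :: nat}"
  have "dope_matrices m n \<subseteq> mat m (n + 1) ` ?F"
  proof
    fix A assume "A \<in> dope_matrices m n"
    then obtain P \<Lambda> where P: "degree P = n" "length \<Lambda> = m" "A = dope_matrix P \<Lambda>"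
      by (auto simp: dope_matrices_def)
    define f where "f = restrict (\<lambda>ij. A $$ ij) ?I"
    have "f \<in> ?F" using P by (auto simp: f_def dope_matrix_def split: if_splits)
    moreover have "A = mat m (n + 1) f"
      by (rule eq_matI) (use P in \<open>auto simp: f_def dope_matrix_def\<close>)
    ultimately show "A \<in> mat m (n + 1) ` ?F" by blast
  qed
  moreover have "finite ?F" by (intro finite_PiE) auto
  ultimately show ?thesis by (meson finite_imageI finite_subset)
qed

end

theory Submission
  imports
    Defs
    "HOL-Computational_Algebra.Fundamental_Theorem_Algebra"
    "HOL-Combinatorics.Multiset_Permutations"
    "HOL-Library.FuncSet"
    "HOL-Real_Asymp.Real_Asymp"
begin

text \<open>
  Let \<open>T = (n\<^sup>2 + n) / 2\<close>, called \<open>triangle n\<close> below. The derivative of order \<open>j\<close> has at most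
  \<open>n - j\<close> zeros, so a dope matrix has at most \<open>T\<close> ones and at most \<open>T\<close> nonzero rows. Almost every
  point gives a zero row, hence zero rows can be inserted anywhere, and which matrices occur depends
  only on the multiset of nonzero rows. Calling such a multiset realizable if it is contained in the
  multiset of all nonzero rows of some polynomial (its profile), one gets
  the sum over all realizable \<open>M\<close> of the number of arrangements of \<open>M\<close> times
  \<open>m choose size M\<close> as the number of dope matrices (\<open>card_dope_matrices\<close>). This is a polynomial
  in \<open>m\<close>.

  Its leading terms come from the realizable multisets with \<open>T\<close> and \<open>T - 1\<close> rows. With \<open>T\<close> rows, each
  row has a single 1 and each column is full. This is the profile of a generic polynomial,
  and it has \<open>T! / (1! 2! \<dots> n!)\<close> arrangements. With \<open>T - 1\<close> rows, either one zero of such a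
  polynomial is not among the chosen points, or one row has two ones, in columns \<open>i < j\<close>. Here \<open>j = i + 1\<close> is
  impossible: it would mean a double root of the derivative of order \<open>i\<close>, which costs a further 1
  (\<open>realizable_second\<close>). Dividing multinomial coefficients, the pair \<open>(i, j)\<close> contributes the fraction
  \<open>(n - i) (n - j) / T\<close> of the leading coefficient, and these fractions sum to
  \<open>(n - 1) (n - 2) / 4\<close>.

  That these profiles occur is shown by integrating repeatedly: at each step only finitely
  many constants of integration cause an unwanted common zero
  (\<open>generic_iterated_antiderivative\<close>). For a prescribed common zero of the derivatives of orders \<open>i\<close>
  and \<open>j\<close>, the constant of order \<open>i\<close> is used up, but the one of order \<open>i + 1\<close> is still free and
  suffices, provided that \<open>j\<close> is at least \<open>i + 2\<close> (\<open>coincidence_antiderivative\<close>).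

  For both asymptotic statements, the generic profile gives the lower bound. The upper bound
  (\<open>card_dope_matrices_le\<close>) chooses the columns independently, which gives
  \<open>(n + 1)! m^T / (1! 2! \<dots> n!)\<close>. If \<open>m\<close> has order \<open>n\<^sup>2\<close>, the logarithms of the bounds
  differ by \<open>O(T)\<close>, while the logarithms themselves have order \<open>T ln n\<close>. If \<open>ln m\<close> outgrows \<open>ln n\<close>,
  they differ by \<open>O(T ln n)\<close> and have order \<open>T ln m\<close>.
\<close>

section \<open>Zeros of derivatives at a point\<close>

text \<open>
  The support of the row that a point contributes to a dope matrix. Order \<open>degree P\<close> is left out
  because that derivative is a nonzero constant, so its column is always zero.
\<close>

definition zero_orders :: "complex poly \<Rightarrow> complex \<Rightarrow> nat set" where
  "zero_orders P z = {j. j < degree P \<and> poly ((pderiv ^^ j) P) z = 0}"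

lemma zero_orders_subset: "zero_orders P z \<subseteq> {..<degree P}"
  by (auto simp: zero_orders_def)

lemma finite_zero_orders [simp]: "finite (zero_orders P z)"
  using zero_orders_subset finite_subset by blast

lemma higher_pderiv_nonzero:
  fixes P :: "complex poly"
  assumes "j < degree P"
  shows "(pderiv ^^ j) P \<noteq> 0"
  using degree_higher_pderiv[of j P] assms by auto

lemma higher_pderiv_degree_const:
  fixes P :: "complex poly"
  assumes "P \<noteq> 0"
  shows "\<exists>c. c \<noteq> 0 \<and> (pderiv ^^ degree P) P = [:c:]"
proof -
  have "degree ((pderiv ^^ degree P) P) = 0"
    by (simp add: degree_higher_pderiv)
  moreover have "coeff ((pderiv ^^ degree P) P) 0 \<noteq> 0"
    using assms by (simp add: coeff_higher_pderiv flip: pochhammer_fact)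
  ultimately show ?thesis
    by (metis coeff_pCons_0 degree_eq_zeroE)
qed

lemma finite_order_zeros: "finite {z. j \<in> zero_orders P z}"
proof (cases "j < degree P")
  case True
  then show ?thesis
    using poly_roots_finite[OF higher_pderiv_nonzero[OF True]] by (simp add: zero_orders_def)
qed (simp add: zero_orders_def)

lemma finite_critical: "finite {z. zero_orders P z \<noteq> {}}"
proof -
  have "{z. zero_orders P z \<noteq> {}} = (\<Union>j<degree P. {z. j \<in> zero_orders P z})"
    by (auto simp: zero_orders_def)
  then show ?thesis using finite_order_zeros by simp
qed

lemma card_order_zeros_le: "card {z. j \<in> zero_orders P z} \<le> degree P - j"
proof (cases "j < degree P")
  case True
  then show ?thesis
    using card_poly_roots_bound[OF higher_pderiv_nonzero[OF True]]
    by (simp add: zero_orders_def degree_higher_pderiv)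
qed (simp add: zero_orders_def)

lemma card_roots_less_if_double_root:
  fixes p :: "complex poly"
  assumes "poly p z = 0" "poly (pderiv p) z = 0" "p \<noteq> 0"
  shows "card {x. poly p x = 0} < degree p"
proof -
  obtain q where q: "p = [:-z, 1:] * q"
    using assms(1) by (metis dvdE poly_eq_0_iff_dvd)
  have q0: "q \<noteq> 0" using q assms(3) by auto
  have "poly q z = 0"
    using assms(2) unfolding q pderiv_mult by (simp add: pderiv_pCons)
  then have "{x. poly p x = 0} = {x. poly q x = 0}"
    unfolding q by (auto simp: algebra_simps)
  then have "card {x. poly p x = 0} \<le> degree q"
    using card_poly_roots_bound[OF q0] by simp
  moreover have "degree p = Suc (degree q)"
    unfolding q using q0 by (subst degree_mult_eq) auto
  ultimately show ?thesis by simp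
qed

lemma card_roots_eq_degree_if_rsquarefree:
  fixes p :: "complex poly"
  assumes "rsquarefree p"
  shows "card {x. poly p x = 0} = degree p"
proof -
  have p: "p \<noteq> 0" using assms by (simp add: rsquarefree_def)
  have "degree p = degree (Polynomial.smult (lead_coeff p) (\<Prod>z|poly p z = 0. [:-z, 1:]))"
    using complex_poly_decompose_rsquarefree[OF assms] by simp
  also have "\<dots> = card {x. poly p x = 0}"
    using p by (simp add: degree_prod_eq_sum_degree)
  finally show ?thesis by simp
qed

text \<open>
  A point at which two consecutive derivatives vanish is a double root of the first of them, so it
  costs a column one of its at most \<open>degree P - j\<close> ones.
\<close>

lemma card_order_zeros_less:
  assumes "j \<in> zero_orders P z" "Suc j \<in> zero_orders P z"
  shows "card {z. j \<in> zero_orders P z} < degree P - j"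
proof -
  have "j < degree P" using assms(1) by (simp add: zero_orders_def)
  then show ?thesis
    using card_roots_less_if_double_root[of "(pderiv ^^ j) P" z] higher_pderiv_nonzero assms
    by (simp add: zero_orders_def degree_higher_pderiv)
qed

text \<open>
  Conversely, a column falls short of its maximum only because of a double root, and a double root
  shows up as two consecutive ones in a row.
\<close>

lemma card_order_zeros_eq:
  assumes j: "j < degree P"
    and sep: "\<And>z. j \<in> zero_orders P z \<Longrightarrow> Suc j \<notin> zero_orders P z"
  shows "card {z. j \<in> zero_orders P z} = degree P - j"
proof -
  have P: "P \<noteq> 0" using j by auto
  have "rsquarefree ((pderiv ^^ j) P)"
    unfolding rsquarefree_roots
  proof (intro allI notI, elim conjE)
    fix a
    assume a: "poly ((pderiv ^^ j) P) a = 0" "poly (pderiv ((pderiv ^^ j) P)) a = 0"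
    show False
    proof (cases "Suc j < degree P")
      case True
      then show False using sep[of a] a j by (simp add: zero_orders_def)
    next
      case False
      then have "degree P = Suc j" using j by simp
      then show False using higher_pderiv_degree_const[OF P] a(2) by auto
    qed
  qed
  then show ?thesis
    using card_roots_eq_degree_if_rsquarefree[of "(pderiv ^^ j) P"] j
    by (simp add: zero_orders_def degree_higher_pderiv)
qed

section \<open>Polynomials with prescribed common zeros\<close>

lemma ex_antiderivative:
  fixes Q :: "complex poly"
  shows "\<exists>R. pderiv R = Q"
proof
  let ?R = "\<Sum>i\<le>degree Q. monom (coeff Q i / of_nat (Suc i)) (Suc i)"
  have "pderiv ?R = (\<Sum>i\<le>degree Q. monom (coeff Q i) i)"
    by (simp add: higher_pderiv_sum[of 1, simplified] pderiv_monom del: of_nat_Suc)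
  then show "pderiv ?R = Q" by (simp add: poly_as_sum_of_monoms)
qed

lemma degree_antiderivative:
  fixes R :: "complex poly"
  assumes "pderiv R \<noteq> 0"
  shows "degree R = Suc (degree (pderiv R))"
proof -
  have "degree R \<noteq> 0" using assms pderiv_eq_0_iff by blast
  then show ?thesis by (simp add: degree_pderiv)
qed

lemma Suc_in_zero_orders_iff:
  assumes "pderiv R \<noteq> 0"
  shows "Suc j \<in> zero_orders R z \<longleftrightarrow> j \<in> zero_orders (pderiv R) z"
  using degree_antiderivative[OF assms] by (simp add: zero_orders_def funpow_swap1)

lemma zero_in_zero_orders_iff:
  assumes "pderiv R \<noteq> 0"
  shows "0 \<in> zero_orders R z \<longleftrightarrow> poly R z = 0"
  using degree_antiderivative[OF assms] by (simp add: zero_orders_def)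

lemma ex_outside_finite:
  fixes A :: "complex set"
  assumes "finite A"
  shows "\<exists>c. c \<notin> A"
  using assms ex_new_if_finite infinite_UNIV_char_0 by blast

text \<open>
  Each zero of \<open>Q\<close> or of one of its derivatives excludes a single constant of integration, so all but finitely
  many antiderivatives avoid the zeros of \<open>Q\<close> and of all its derivatives.
\<close>

lemma generic_antiderivative:
  fixes Q :: "complex poly"
  shows "\<exists>R. pderiv R = Q \<and> (\<forall>z. poly R z = 0 \<longrightarrow> zero_orders Q z = {})"
proof -
  obtain R where R: "pderiv R = Q" using ex_antiderivative by blast
  have "finite ((\<lambda>z. - poly R z) ` {z. zero_orders Q z \<noteq> {}})"
    using finite_critical by simp
  then obtain c where c: "c \<notin> (\<lambda>z. - poly R z) ` {z. zero_orders Q z \<noteq> {}}"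
    using ex_outside_finite by blast
  have "pderiv (R + [:c:]) = Q" using R by (simp add: pderiv_add pderiv_pCons)
  moreover have "zero_orders Q z = {}" if "poly (R + [:c:]) z = 0" for z
  proof (rule ccontr)
    assume "zero_orders Q z \<noteq> {}"
    moreover have "c = - poly R z" using that by (simp add: add_eq_0_iff)
    ultimately show False using c by blast
  qed
  ultimately show ?thesis by blast
qed

text \<open>
  Integrating \<open>i\<close> times with generic constants shifts the zero pattern of \<open>Q\<close> by \<open>i\<close> columns, and
  the zeros in the \<open>i\<close> new columns coincide neither with these nor with each other.
\<close>

lemma generic_iterated_antiderivative:
  fixes Q :: "complex poly"
  assumes "Q \<noteq> 0"
  shows "\<exists>P. degree P = degree Q + i \<and> P \<noteq> 0 \<and>
           (\<forall>z k. i + k \<in> zero_orders P z \<longleftrightarrow> k \<in> zero_orders Q z) \<and>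
           (\<forall>z k. k < i \<and> k \<in> zero_orders P z \<longrightarrow> zero_orders P z = {k})"
proof (induction i)
  case 0
  show ?case using assms by (intro exI[of _ Q]) auto
next
  case (Suc i)
  then obtain P where P: "degree P = degree Q + i" "P \<noteq> 0"
    "\<And>z k. i + k \<in> zero_orders P z \<longleftrightarrow> k \<in> zero_orders Q z"
    "\<And>z k. k < i \<Longrightarrow> k \<in> zero_orders P z \<Longrightarrow> zero_orders P z = {k}"
    by blast
  obtain R where R: "pderiv R = P" "\<And>z. poly R z = 0 \<Longrightarrow> zero_orders P z = {}"
    using generic_antiderivative by blast
  have R0: "pderiv R \<noteq> 0" using R P by simp
  have S: "Suc k \<in> zero_orders R z \<longleftrightarrow> k \<in> zero_orders P z" for k z
    using Suc_in_zero_orders_iff[OF R0] R(1) by simp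
  have Z: "0 \<in> zero_orders R z \<longleftrightarrow> poly R z = 0" for z
    using zero_in_zero_orders_iff[OF R0] .
  have "zero_orders R z = {k}" if k: "k < Suc i" "k \<in> zero_orders R z" for z k
  proof (cases k)
    case 0
    then have e: "zero_orders P z = {}" using k Z R(2) by simp
    have "x = 0" if "x \<in> zero_orders R z" for x
      using that e S by (cases x) auto
    then show ?thesis using k 0 by blast
  next
    case (Suc l)
    then have l: "zero_orders P z = {l}" using P(4)[of l z] k S by simp
    have "x = k" if "x \<in> zero_orders R z" for x
    proof (cases x)
      case 0
      then show ?thesis using that Z R(2)[of z] l by simp
    next
      case (Suc y)
      then show ?thesis using that S l \<open>k = Suc l\<close> by auto
    qed
    then show ?thesis using k by blast
  qed
  moreover have "Suc i + k \<in> zero_orders R z \<longleftrightarrow> k \<in> zero_orders Q z" for z k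
    using S[of "i + k" z] P(3)[of k z] by simp
  moreover have "degree R = degree Q + Suc i"
    using degree_antiderivative[OF R0] R(1) P(1) by simp
  ultimately show ?case using R0 by (intro exI[of _ R]) auto
qed

lemma ex_generic_poly:
  "\<exists>P. degree P = n \<and> P \<noteq> 0 \<and> (\<forall>z k. k \<in> zero_orders P z \<longrightarrow> zero_orders P z = {k})"
proof -
  obtain P where P: "degree P = n" "P \<noteq> 0"
    "\<And>z k. k < n \<Longrightarrow> k \<in> zero_orders P z \<Longrightarrow> zero_orders P z = {k}"
    using generic_iterated_antiderivative[of 1 n] by auto
  moreover have "k < n" if "k \<in> zero_orders P z" for k z
    using that P(1) by (simp add: zero_orders_def)
  ultimately show ?thesis by blast
qed

text \<open>
  Integrating \<open>Q\<close> twice while forcing the result \<open>R\<close> to vanish at a chosen point \<open>a\<close> leaves only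
  the constant \<open>c\<close> of the first integration free. Writing \<open>E\<close> for the double antiderivative with
  \<open>c = 0\<close> that vanishes at \<open>a\<close> and factoring \<open>E = (x - a) G\<close>, one has \<open>R = (x - a) (G + c)\<close>.
  Every unwanted coincidence makes \<open>c\<close> the negative of a value of \<open>G\<close> at a critical point of \<open>G\<close>
  or at a zero of \<open>Q\<close> or one of its derivatives, or of a value of the antiderivative \<open>F\<close> of \<open>Q\<close>
  at such a zero; so only finitely many \<open>c\<close> are bad. Two integrations are needed because with a single one
  no constant would remain free.
\<close>

lemma coincidence_antiderivative:
  fixes Q :: "complex poly"
  assumes Q: "Q \<noteq> 0" and a: "zero_orders Q a \<noteq> {}"
  shows "\<exists>R. pderiv (pderiv R) = Q \<and> poly R a = 0 \<and>
    (\<forall>z. poly (pderiv R) z = 0 \<longrightarrow> zero_orders Q z = {} \<and> poly R z \<noteq> 0) \<and>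
    (\<forall>z. poly R z = 0 \<and> z \<noteq> a \<longrightarrow> zero_orders Q z = {})"
proof -
  obtain F where F: "pderiv F = Q" using ex_antiderivative by blast
  obtain E0 where E0: "pderiv E0 = F" using ex_antiderivative by blast
  define E where "E = E0 - [:poly E0 a:]"
  have E: "pderiv E = F" "poly E a = 0"
    using E0 by (simp_all add: E_def pderiv_diff pderiv_pCons)
  obtain G where G: "E = [:-a, 1:] * G"
    using E(2) by (metis dvdE poly_eq_0_iff_dvd)
  have dF: "degree F = Suc (degree Q)" using degree_antiderivative[of F] F Q by simp
  then have F0: "F \<noteq> 0" by auto
  have dE: "degree E = Suc (degree F)" using degree_antiderivative[of E] E(1) F0 by simp
  then have G0: "G \<noteq> 0" using G by auto
  \<comment> \<open>\<open>G\<close> is not constant, so it has only finitely many critical points.\<close>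
  have "degree E = Suc (degree G)"
    unfolding G using G0 by (subst degree_mult_eq) auto
  then have "degree G \<noteq> 0" using dE dF by simp
  then have G': "pderiv G \<noteq> 0" by (simp add: pderiv_eq_0_iff)
  let ?Z = "{z. zero_orders Q z \<noteq> {}}"
  define B where "B = (\<lambda>z. - poly F z) ` ?Z \<union> (\<lambda>z. - poly G z) ` ?Z \<union>
    (\<lambda>z. - poly G z) ` {z. poly (pderiv G) z = 0}"
  have "finite B"
    unfolding B_def using finite_critical poly_roots_finite[OF G'] by blast
  then obtain c where c: "c \<notin> B" using ex_outside_finite by blast
  define R where "R = [:-a, 1:] * (G + [:c:])"
  have R: "poly R z = (z - a) * (poly G z + c)" for z
    by (simp add: R_def algebra_simps)
  have "R = E + [:-a, 1:] * [:c:]" by (simp only: R_def G distrib_left)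
  then have R': "pderiv R = F + [:c:]" using E(1) by (simp add: pderiv_add pderiv_pCons)
  have R'': "poly (pderiv R) z = (z - a) * poly (pderiv G) z + (poly G z + c)" for z
    unfolding R_def pderiv_mult by (simp add: pderiv_add pderiv_pCons algebra_simps)
  have "zero_orders Q z = {} \<and> poly R z \<noteq> 0" if z: "poly (pderiv R) z = 0" for z
  proof -
    have "c = - poly F z" using z R' by (simp add: add_eq_0_iff)
    then have *: "zero_orders Q z = {}" using c by (auto simp: B_def)
    have "poly R z \<noteq> 0"
    proof
      assume "poly R z = 0"
      moreover have "z \<noteq> a" using * a by auto
      ultimately have g: "poly G z + c = 0" using R by simp
      then have "poly (pderiv G) z = 0" using z R''[of z] \<open>z \<noteq> a\<close> by simp
      moreover have "c = - poly G z" using g by (simp add: add_eq_0_iff)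
      ultimately show False using c by (auto simp: B_def)
    qed
    with * show ?thesis by simp
  qed
  moreover have "zero_orders Q z = {}" if "poly R z = 0" "z \<noteq> a" for z
  proof (rule ccontr)
    assume "zero_orders Q z \<noteq> {}"
    moreover have "c = - poly G z" using that R[of z] by (simp add: add_eq_0_iff)
    ultimately show False using c by (auto simp: B_def)
  qed
  moreover have "pderiv (pderiv R) = Q" using R' F by (simp add: pderiv_add pderiv_pCons)
  moreover have "poly R a = 0" using R by simp
  ultimately show ?thesis by blast
qed

text \<open>
  Let \<open>Q\<close>, the future derivative of order \<open>i + 2\<close>, be generic, and let \<open>a\<close> be a zero of its derivative
  of order \<open>j - i - 2\<close>, which exists by the fundamental theorem of algebra. Two integrations that
  force a zero at \<open>a\<close>, followed by \<open>i\<close> generic ones, produce exactly one coincidence.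
\<close>

lemma ex_single_coincidence_poly:
  assumes ij: "i + 2 \<le> j" "j < n"
  shows "\<exists>P a. degree P = n \<and> P \<noteq> 0 \<and> zero_orders P a = {i, j} \<and>
    (\<forall>z k. z \<noteq> a \<and> k \<in> zero_orders P z \<longrightarrow> zero_orders P z = {k})"
proof -
  define d where "d = j - i - 2"
  define m where "m = n - i - 2"
  obtain Q where Q: "degree Q = m" "Q \<noteq> 0"
    "\<And>z k. k \<in> zero_orders Q z \<Longrightarrow> zero_orders Q z = {k}"
    using ex_generic_poly by blast
  have d: "d < m" using ij by (simp add: d_def m_def)
  then have "\<not> constant (poly ((pderiv ^^ d) Q))"
    using Q(1) by (simp add: constant_degree degree_higher_pderiv)
  then obtain a where "poly ((pderiv ^^ d) Q) a = 0"
    using fundamental_theorem_of_algebra by blast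
  then have "d \<in> zero_orders Q a" using d Q(1) by (simp add: zero_orders_def)
  then have a: "zero_orders Q a = {d}" using Q(3) by simp
  then obtain R where R: "pderiv (pderiv R) = Q" "poly R a = 0"
    "\<And>z. poly (pderiv R) z = 0 \<Longrightarrow> zero_orders Q z = {} \<and> poly R z \<noteq> 0"
    "\<And>z. poly R z = 0 \<Longrightarrow> z \<noteq> a \<Longrightarrow> zero_orders Q z = {}"
    using coincidence_antiderivative[OF Q(2), of a] by blast
  have nz: "pderiv (pderiv R) \<noteq> 0" "pderiv R \<noteq> 0" using R(1) Q(2) by auto
  have S: "Suc (Suc k) \<in> zero_orders R z \<longleftrightarrow> k \<in> zero_orders Q z" for k z
    using Suc_in_zero_orders_iff[OF nz(1)] Suc_in_zero_orders_iff[OF nz(2)] R(1) by simp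
  have S1: "Suc 0 \<in> zero_orders R z \<longleftrightarrow> poly (pderiv R) z = 0" for z
    using Suc_in_zero_orders_iff[OF nz(2)] zero_in_zero_orders_iff[OF nz(1)] by simp
  have S0: "0 \<in> zero_orders R z \<longleftrightarrow> poly R z = 0" for z
    using zero_in_zero_orders_iff[OF nz(2)] .
  have Ra: "x \<in> zero_orders R a \<longleftrightarrow> x = 0 \<or> x = d + 2" for x
  proof -
    consider "x = 0" | "x = Suc 0" | y where "x = Suc (Suc y)"
      by (metis not0_implies_Suc)
    then show ?thesis
      using S0 S1 S R(2) R(3)[of a] a by cases auto
  qed
  have Rz: "x = y" if "z \<noteq> a" and xy: "x \<in> zero_orders R z" "y \<in> zero_orders R z" for x y z
  proof -
    consider "x = 0" | "x = Suc 0" | x' where "x = Suc (Suc x')"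
      by (metis not0_implies_Suc)
    note cx = this
    consider "y = 0" | "y = Suc 0" | y' where "y = Suc (Suc y')"
      by (metis not0_implies_Suc)
    then show ?thesis
      using S0[of z] S1[of z] S[of _ z] R(3)[of z] R(4)[of z] Q(3)[of _ z] xy \<open>z \<noteq> a\<close>
      by cases (rule cx; force)+
  qed
  have "degree R = m + 2"
    using degree_antiderivative[OF nz(1)] degree_antiderivative[OF nz(2)] R(1) Q(1) by simp
  then have "degree R + i = n" using ij by (simp add: m_def)
  moreover have "R \<noteq> 0" using nz by auto
  ultimately obtain P where P: "degree P = n" "P \<noteq> 0"
    "\<And>z k. i + k \<in> zero_orders P z \<longleftrightarrow> k \<in> zero_orders R z"
    "\<And>z k. k < i \<Longrightarrow> k \<in> zero_orders P z \<Longrightarrow> zero_orders P z = {k}"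
    using generic_iterated_antiderivative[of R i] by metis
  have ia: "i \<in> zero_orders P a" using P(3)[of 0 a] Ra by simp
  have "x \<in> zero_orders P a \<longleftrightarrow> x = i \<or> x = j" for x
  proof (cases "x < i")
    case True
    then show ?thesis using P(4)[OF True, of a] ia ij by auto
  next
    case False
    then show ?thesis using P(3)[of "x - i" a] Ra[of "x - i"] ij by (auto simp: d_def)
  qed
  then have "zero_orders P a = {i, j}" by blast
  moreover have "zero_orders P z = {k}" if "z \<noteq> a" and k: "k \<in> zero_orders P z" for z k
  proof (cases "k < i")
    case True
    then show ?thesis using P(4) k by blast
  next
    case False
    have "x = k" if x: "x \<in> zero_orders P z" for x
    proof (cases "x < i")
      case True
      then show ?thesis using P(4)[OF True x] k by auto
    next
      case xi: False
      then have "x - i = k - i"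
        using Rz[OF \<open>z \<noteq> a\<close>] P(3)[of "x - i" z] P(3)[of "k - i" z] x k False by simp
      then show ?thesis using False xi by simp
    qed
    then show ?thesis using k by blast
  qed
  ultimately show ?thesis using P(1,2) by blast
qed

section \<open>Profiles of polynomials\<close>

definition triangle :: "nat \<Rightarrow> nat" where
  "triangle n = (n\<^sup>2 + n) div 2"

lemma sum_diff_eq_triangle: "(\<Sum>j<n. n - j) = triangle n"
proof -
  have "2 * (\<Sum>j<n. n - j) = n * (n + 1)"
    by (induction n) (simp_all add: sum.lessThan_Suc_shift del: sum.lessThan_Suc)
  then show ?thesis by (simp add: triangle_def power2_eq_square)
qed

lemma two_triangle: "2 * triangle n = n * (n + 1)"
  by (simp add: triangle_def power2_eq_square)

lemma real_triangle: "real (triangle n) = real n * (real n + 1) / 2"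
  using arg_cong[OF two_triangle[of n], of real] by (simp add: algebra_simps)

text \<open>
  The multiset of rows with at least one 1 in a dope matrix whose points include all zeros of all
  derivatives. Every other dope matrix of \<open>P\<close> arises by dropping some of these rows, adding zero
  rows, and ordering the result.
\<close>

definition profile :: "complex poly \<Rightarrow> nat set multiset" where
  "profile P = image_mset (zero_orders P) (mset_set {z. zero_orders P z \<noteq> {}})"

definition realizable :: "nat \<Rightarrow> nat set multiset set" where
  "realizable n = {M. \<exists>P. P \<noteq> 0 \<and> degree P = n \<and> M \<subseteq># profile P}"

lemma in_profile_iff: "x \<in># profile P \<longleftrightarrow> x \<noteq> {} \<and> (\<exists>z. x = zero_orders P z)"
  using finite_critical[of P] by (auto simp: profile_def)

lemma size_filter_profile:
  "size {#x \<in># profile P. j \<in> x#} = card {z. j \<in> zero_orders P z}"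
proof -
  have "{z. zero_orders P z \<noteq> {} \<and> j \<in> zero_orders P z} = {z. j \<in> zero_orders P z}" by auto
  then show ?thesis
    using finite_critical[of P] by (simp add: profile_def filter_mset_image_mset)
qed

text \<open>
  Counting the ones of a matrix by rows and by columns.
\<close>

lemma sum_card_eq_sum_columns:
  fixes M :: "nat set multiset"
  assumes "\<forall>x \<in># M. x \<subseteq> {..<n}"
  shows "(\<Sum>x\<in>#M. card x) = (\<Sum>j<n. size {#x \<in># M. j \<in> x#})"
  using assms
proof (induction M)
  case (add x M)
  have "card x = (\<Sum>j\<in>{..<n}. if j \<in> x then 1 else 0)"
    using add.prems by (simp add: Int_absorb1 flip: sum.inter_restrict)
  moreover have "size {#y \<in># add_mset x M. j \<in> y#} = (if j \<in> x then 1 else 0) + size {#y \<in># M. j \<in> y#}"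
    for j by simp
  ultimately show ?case using add by (simp add: sum.distrib del: filter_mset_add_mset)
qed simp

lemma sum_card_profile:
  assumes "degree P = n"
  shows "(\<Sum>x\<in>#profile P. card x) = (\<Sum>j<n. card {z. j \<in> zero_orders P z})"
proof -
  have "\<forall>x \<in># profile P. x \<subseteq> {..<n}"
    using subsetD[OF zero_orders_subset[of P]] assms by (auto simp: in_profile_iff)
  then show ?thesis using sum_card_eq_sum_columns by (simp add: size_filter_profile)
qed

text \<open>
  The second summand on the right measures how far a multiset of rows is from consisting of
  single ones.
\<close>

lemma sum_card_split:
  assumes "\<forall>x \<in># M. finite x \<and> x \<noteq> {}"
  shows "(\<Sum>x\<in>#M. card x) = size M + (\<Sum>x\<in>#M. card x - 1)"
  using assms
proof (induction M)
  case (add x M)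
  then have "card x > 0" by (simp add: card_gt_0_iff)
  then show ?case using add by simp
qed simp

lemma profile_elem_finite: "\<forall>x \<in># profile P. finite x \<and> x \<noteq> {}"
  by (auto simp: in_profile_iff)

lemma size_profile_le: "size (profile P) \<le> triangle (degree P)"
proof -
  have "size (profile P) \<le> (\<Sum>x\<in>#profile P. card x)"
    using sum_card_split[OF profile_elem_finite] by simp
  also have "\<dots> \<le> (\<Sum>j<degree P. degree P - j)"
    using sum_card_profile[OF refl, of P] by (simp add: sum_mono card_order_zeros_le)
  finally show ?thesis by (simp add: sum_diff_eq_triangle)
qed

text \<open>
  Two consecutive ones in a row cost twice: the column of the first one is not full, so there are
  fewer than \<open>triangle (degree P)\<close> ones, and the row spends two of them. Hence the profile would
  have at most \<open>triangle (degree P) - 2\<close> rows.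
\<close>

lemma no_consecutive_zeros:
  assumes "triangle (degree P) \<le> size (profile P) + 1" "j \<in> zero_orders P z"
  shows "Suc j \<notin> zero_orders P z"
proof
  assume S: "Suc j \<in> zero_orders P z"
  let ?n = "degree P"
  have j: "j < ?n" using assms(2) by (simp add: zero_orders_def)
  have "card {j, Suc j} \<le> card (zero_orders P z)"
    using assms(2) S by (intro card_mono) auto
  then have "1 \<le> card (zero_orders P z) - 1" by simp
  also have "\<dots> \<le> (\<Sum>x\<in>#profile P. card x - 1)"
  proof -
    have "zero_orders P z \<in># profile P" using assms(2) by (auto simp: in_profile_iff)
    then obtain M where "profile P = add_mset (zero_orders P z) M" using mset_add by metis
    then show ?thesis by simp
  qed
  finally have "size (profile P) + 1 \<le> (\<Sum>j<?n. card {z. j \<in> zero_orders P z})"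
    using sum_card_split[OF profile_elem_finite, of P] sum_card_profile[OF refl, of P] by simp
  also have "\<dots> < (\<Sum>j<?n. ?n - j)"
    using j card_order_zeros_less[OF assms(2) S] card_order_zeros_le
    by (intro sum_strict_mono_ex1) auto
  finally show False using assms(1) by (simp add: sum_diff_eq_triangle)
qed

lemma card_order_zeros_eq_if_large_profile:
  assumes "triangle (degree P) \<le> size (profile P) + 1" "j < degree P"
  shows "card {z. j \<in> zero_orders P z} = degree P - j"
  using card_order_zeros_eq[OF assms(2)] no_consecutive_zeros[OF assms(1)] by blast

section \<open>The largest realizable multisets of rows\<close>

text \<open>
  The profile of a polynomial for which all zeros of all derivatives are simple and no two
  derivatives have a common zero.
\<close>

definition generic_profile :: "nat \<Rightarrow> nat set multiset" where
  "generic_profile n = (\<Sum>j<n. replicate_mset (n - j) {j})"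

lemma count_generic_profile: "count (generic_profile n) {j} = n - j"
  by (simp add: generic_profile_def count_sum)

lemma size_generic_profile: "size (generic_profile n) = triangle n"
  by (simp add: generic_profile_def sum_diff_eq_triangle size_multiset_sum)

lemma set_mset_generic_profile: "set_mset (generic_profile n) = (\<lambda>j. {j}) ` {..<n}"
  by (auto simp: generic_profile_def set_mset_sum split: if_splits)

text \<open>
  A multiset of singletons is determined by its column counts.
\<close>

lemma eq_generic_profileI:
  assumes 1: "\<And>x. x \<in># M \<Longrightarrow> \<exists>j<n. x = {j}"
    and 2: "\<And>j. j < n \<Longrightarrow> size {#x \<in># M. j \<in> x#} = n - j"
  shows "M = generic_profile n"
proof (rule multiset_eqI)
  fix x
  show "count M x = count (generic_profile n) x"
  proof (cases "\<exists>j<n. x = {j}")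
    case True
    then obtain j where j: "j < n" "x = {j}" by blast
    have "{#x \<in># M. j \<in> x#} = {#x \<in># M. x = {j}#}"
      using 1 by (intro filter_mset_cong) auto
    then show ?thesis
      using 2[OF j(1)] j(2) by (simp add: count_generic_profile filter_eq_replicate_mset)
  next
    case False
    then have "count M x = 0" using 1 count_inI by metis
    moreover have "count (generic_profile n) x = 0"
      using False set_mset_generic_profile[of n] by (auto simp: count_eq_zero_iff)
    ultimately show ?thesis by simp
  qed
qed

lemma profile_eq_generic:
  assumes "degree P = n" "\<And>z. card (zero_orders P z) \<le> 1"
    and "\<And>j. j < n \<Longrightarrow> card {z. j \<in> zero_orders P z} = n - j"
  shows "profile P = generic_profile n"
proof (rule eq_generic_profileI)
  fix x assume "x \<in># profile P"
  then obtain z where z: "x = zero_orders P z" "x \<noteq> {}" by (auto simp: in_profile_iff)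
  then have "card x \<noteq> 0" by simp
  moreover have "card x \<le> 1" using assms(2)[of z] z by simp
  ultimately have "card x = 1" by linarith
  then obtain j where "x = {j}" by (auto simp: card_1_singleton_iff)
  then show "\<exists>j<n. x = {j}" using z zero_orders_subset[of P z] assms(1) by auto
qed (use assms(3) size_filter_profile in auto)

lemma ex_generic_profile: "\<exists>P. P \<noteq> 0 \<and> degree P = n \<and> profile P = generic_profile n"
proof -
  obtain P where P: "degree P = n" "P \<noteq> 0"
    "\<And>z k. k \<in> zero_orders P z \<Longrightarrow> zero_orders P z = {k}"
    using ex_generic_poly by blast
  have c: "card (zero_orders P z) \<le> 1" for z
    using P(3)[of _ z] by (cases "zero_orders P z = {}") (force simp: card_1_singleton_iff)+
  have "Suc j \<notin> zero_orders P z" if "j \<in> zero_orders P z" for j z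
    using P(3)[OF that] by auto
  then have "card {z. j \<in> zero_orders P z} = n - j" if "j < n" for j
    using card_order_zeros_eq[of j P] that P(1) by blast
  then have "profile P = generic_profile n" using profile_eq_generic[OF P(1) c] by simp
  then show ?thesis using P(1,2) by blast
qed

lemma profile_top:
  assumes "degree P = n" "size (profile P) = triangle n"
  shows "profile P = generic_profile n"
proof (rule profile_eq_generic[OF assms(1)])
  have col: "card {z. j \<in> zero_orders P z} = n - j" if "j < n" for j
    using card_order_zeros_eq_if_large_profile[of P j] that assms by simp
  then show "card {z. j \<in> zero_orders P z} = n - j" if "j < n" for j using that .
  have "(\<Sum>x\<in>#profile P. card x) = triangle n"
    using sum_card_profile[OF assms(1)] col sum_diff_eq_triangle[of n] by simp
  then have "(\<Sum>x\<in>#profile P. card x - 1) = 0"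
    using sum_card_split[OF profile_elem_finite, of P] assms(2) by simp
  then have "card x - 1 = 0" if "x \<in># profile P" for x using that by simp
  then show "card (zero_orders P z) \<le> 1" for z
    by (cases "zero_orders P z = {}") (auto simp: in_profile_iff)
qed

lemma sum_mset_eq_1D:
  fixes f :: "'a \<Rightarrow> nat"
  assumes "(\<Sum>x\<in>#M. f x) = 1"
  shows "\<exists>x M'. M = add_mset x M' \<and> f x = 1 \<and> (\<forall>y\<in>#M'. f y = 0)"
proof -
  have "\<exists>x\<in>#M. f x \<noteq> 0"
  proof (rule ccontr)
    assume "\<not> ?thesis"
    then have "(\<Sum>x\<in>#M. f x) = 0" by simp
    then show False using assms by simp
  qed
  then obtain x where x: "x \<in># M" "f x \<noteq> 0" by blast
  obtain M' where M: "M = add_mset x M'" using x(1) mset_add by metis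
  have "f x + (\<Sum>y\<in>#M'. f y) = 1" using assms M by simp
  then have "f x = 1" "(\<Sum>y\<in>#M'. f y) = 0" using x(2) by linarith+
  then show ?thesis using M by auto
qed

text \<open>
  The profile in which, compared with the generic one, a zero of the derivative of order \<open>i\<close> and a
  zero of the derivative of order \<open>j\<close> have been merged.
\<close>

definition coincidence_profile :: "nat \<Rightarrow> nat \<Rightarrow> nat \<Rightarrow> nat set multiset" where
  "coincidence_profile n i j = add_mset {i, j} (generic_profile n - {#{i}, {j}#})"

lemma eq_coincidence_profileI:
  assumes ij: "i < j" "j < n"
    and M: "M = add_mset {i, j} M'"
    and 1: "\<And>x. x \<in># M' \<Longrightarrow> \<exists>k<n. x = {k}"
    and 2: "\<And>k. k < n \<Longrightarrow> size {#x \<in># M. k \<in> x#} = n - k"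
  shows "M = coincidence_profile n i j"
proof -
  have "add_mset {i} (add_mset {j} M') = generic_profile n"
  proof (rule eq_generic_profileI)
    fix k assume "k < n"
    then show "size {#x \<in># add_mset {i} (add_mset {j} M'). k \<in> x#} = n - k"
      using 2[of k] ij unfolding M by (auto split: if_splits)
  qed (use 1 ij in auto)
  then have "generic_profile n = M' + {#{i}, {j}#}" by simp
  then have "generic_profile n - {#{i}, {j}#} = M'" by (simp only: add_diff_cancel_right')
  then show ?thesis using M by (simp add: coincidence_profile_def)
qed

text \<open>
  With one row missing all columns are still full, by \<open>no_consecutive_zeros\<close>; so the
  ones exceed the rows by one, and a single row carries two of them. These are not adjacent.
\<close>

lemma profile_second:
  assumes deg: "degree P = n" and sz: "size (profile P) + 1 = triangle n"
  shows "\<exists>i j. i + 2 \<le> j \<and> j < n \<and> profile P = coincidence_profile n i j"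
proof -
  have col: "card {z. j \<in> zero_orders P z} = n - j" if "j < n" for j
    using card_order_zeros_eq_if_large_profile[of P j] that assms by simp
  have "(\<Sum>x\<in>#profile P. card x) = triangle n"
    using sum_card_profile[OF assms(1)] col sum_diff_eq_triangle[of n] by simp
  then have "(\<Sum>x\<in>#profile P. card x - 1) = 1"
    using sum_card_split[OF profile_elem_finite, of P] sz by simp
  then obtain x M' where M: "profile P = add_mset x M'" "card x - 1 = 1" "\<forall>y\<in>#M'. card y - 1 = 0"
    using sum_mset_eq_1D by blast
  have "card x = 2" using M(2) by simp
  then obtain i j where ij: "x = {i, j}" "i < j"
    by (metis card_2_iff insert_commute linorder_neqE_nat)
  have "x \<in># profile P" using M(1) by simp
  then obtain z where z: "zero_orders P z = {i, j}" using ij by (auto simp: in_profile_iff)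
  have "Suc i \<notin> zero_orders P z"
    using no_consecutive_zeros[of P i z] assms z by simp
  then have "i + 2 \<le> j" using z ij(2) by auto
  moreover have "j < n" using zero_orders_subset[of P z] z deg by auto
  moreover have "profile P = coincidence_profile n i j"
  proof (rule eq_coincidence_profileI)
    fix y assume y: "y \<in># M'"
    then have "y \<in># profile P" using M(1) by simp
    then obtain w where w: "y = zero_orders P w" "y \<noteq> {}" by (auto simp: in_profile_iff)
    then have "card y \<noteq> 0" by simp
    moreover have "card y \<le> 1" using M(3) y by force
    ultimately have "card y = 1" by linarith
    then obtain k where "y = {k}" by (auto simp: card_1_singleton_iff)
    then show "\<exists>k<n. y = {k}" using w zero_orders_subset[of P w] deg by auto
  next
    show "size {#x \<in># profile P. k \<in> x#} = n - k" if "k < n" for k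
      using col[OF that] by (simp only: size_filter_profile)
  qed (use \<open>j < n\<close> ij M(1) in auto)
  ultimately show ?thesis by blast
qed

lemma ex_coincidence_profile:
  assumes ij: "i + 2 \<le> j" "j < n"
  shows "\<exists>P. P \<noteq> 0 \<and> degree P = n \<and> profile P = coincidence_profile n i j"
proof -
  from ex_single_coincidence_poly[OF ij] obtain P a where P: "degree P = n" "P \<noteq> 0"
    "zero_orders P a = {i, j}"
    and sep: "\<forall>z k. z \<noteq> a \<and> k \<in> zero_orders P z \<longrightarrow> zero_orders P z = {k}"
    by auto
  have single: "zero_orders P z = {k}" if "z \<noteq> a" "k \<in> zero_orders P z" for z k
    using sep that by simp
  have "Suc k \<notin> zero_orders P z" if k: "k \<in> zero_orders P z" for k z
  proof (cases "z = a")
    case True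
    then have "k = i \<or> k = j" "Suc k \<in> zero_orders P z \<longleftrightarrow> Suc k = i \<or> Suc k = j"
      using k P(3) by simp_all
    then show ?thesis using ij(1) by linarith
  next
    case False
    then show ?thesis using single[OF False k] by simp
  qed
  then have col: "card {z. k \<in> zero_orders P z} = n - k" if "k < n" for k
    using card_order_zeros_eq[of k P] that P(1) by simp
  let ?Z = "{z. zero_orders P z \<noteq> {}}"
  have a: "a \<in> ?Z" using P(3) by simp
  have "mset_set ?Z = add_mset a (mset_set (?Z - {a}))"
    using mset_set.remove[OF finite_critical a] by simp
  then have M: "profile P = add_mset {i, j} (image_mset (zero_orders P) (mset_set (?Z - {a})))"
    using P(3) by (simp add: profile_def)
  have "profile P = coincidence_profile n i j"
  proof (rule eq_coincidence_profileI[OF _ _ M])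
    fix x assume "x \<in># image_mset (zero_orders P) (mset_set (?Z - {a}))"
    then obtain z k where z: "z \<noteq> a" "x = zero_orders P z" "k \<in> x"
      using finite_critical[of P] by auto
    then show "\<exists>k<n. x = {k}" using single[of z k] zero_orders_subset[of P z] P(1) by auto
  next
    show "size {#x \<in># profile P. k \<in> x#} = n - k" if "k < n" for k
      using col[OF that] by (simp only: size_filter_profile)
  qed (use ij in auto)
  then show ?thesis using P by blast
qed

lemma size_realizable_le: "M \<in> realizable n \<Longrightarrow> size M \<le> triangle n"
  using size_profile_le by (auto simp: realizable_def dest!: size_mset_mono intro: order_trans)

lemma realizable_elem:
  assumes "M \<in> realizable n" "x \<in># M"
  shows "x \<noteq> {} \<and> x \<subseteq> {..<n}"
proof -
  obtain P where P: "degree P = n" "x \<in># profile P"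
    using assms by (auto simp: realizable_def dest: mset_subset_eqD)
  then show ?thesis using subsetD[OF zero_orders_subset[of P]] by (auto simp: in_profile_iff)
qed

lemma finite_realizable: "finite (realizable n)"
proof -
  have "realizable n \<subseteq> (\<Union>k\<le>triangle n. multisets_of_size (Pow {..<n}) k)"
    using size_realizable_le realizable_elem by (fastforce simp: multisets_of_size_def)
  then show ?thesis by (rule finite_subset) auto
qed

lemma realizable_top: "{M \<in> realizable n. size M = triangle n} = {generic_profile n}"
proof -
  have "M = generic_profile n" if M: "M \<in> realizable n" "size M = triangle n" for M
  proof -
    obtain P where P: "degree P = n" "M \<subseteq># profile P" using M(1) by (auto simp: realizable_def)
    have "size (profile P) \<le> size M" using size_profile_le[of P] P(1) M(2) by simp
    then have "M = profile P"
      using P(2) by (metis mset_subset_size not_le subset_mset.le_less)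
    then show ?thesis using profile_top[OF P(1)] M(2) by simp
  qed
  moreover have "generic_profile n \<in> realizable n"
    using ex_generic_profile[of n] by (auto simp: realizable_def)
  ultimately show ?thesis using size_generic_profile[of n] by blast
qed

definition nonadjacent_pairs :: "nat \<Rightarrow> (nat \<times> nat) set" where
  "nonadjacent_pairs n = {(i, j). i + 2 \<le> j \<and> j < n}"

lemma singleton_in_generic_profile: "j < n \<Longrightarrow> {j} \<in># generic_profile n"
  by (simp add: set_mset_generic_profile)

lemma pair_subset_generic_profile:
  assumes "i < j" "j < n"
  shows "{#{i}, {j}#} \<subseteq># generic_profile n"
proof -
  have j: "{j} \<in># generic_profile n - {#{i}#}"
    using assms by (simp add: in_diff_count count_generic_profile)
  show ?thesis
    using singleton_in_generic_profile[of i n] j assms by (simp add: insert_subset_eq_iff)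
qed

lemma size_coincidence_profile:
  assumes "i < j" "j < n"
  shows "size (coincidence_profile n i j) + 1 = triangle n"
proof -
  have "size {#{i}, {j}#} \<le> size (generic_profile n)"
    using pair_subset_generic_profile[OF assms] by (rule size_mset_mono)
  then show ?thesis
    using pair_subset_generic_profile[OF assms]
    by (simp add: coincidence_profile_def size_Diff_submset size_generic_profile)
qed

text \<open>
  A profile has at most \<open>triangle n\<close> rows, so a submultiset with \<open>triangle n - 1\<close> rows is either a whole
  profile, covered by \<open>profile_second\<close>, or lacks a single row of a profile of maximal size, which is
  the generic one.
\<close>

lemma realizable_second:
  "{M \<in> realizable n. size M + 1 = triangle n} =
     (\<lambda>j. generic_profile n - {#{j}#}) ` {..<n} \<union>
     (\<lambda>(i, j). coincidence_profile n i j) ` nonadjacent_pairs n" (is "?L = ?A \<union> ?B")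
proof (intro equalityI subsetI)
  fix M assume "M \<in> ?L"
  then have M: "M \<in> realizable n" "size M + 1 = triangle n" by auto
  obtain P where P: "degree P = n" "M \<subseteq># profile P" using M(1) by (auto simp: realizable_def)
  obtain K where K: "profile P = M + K" using P(2) by (metis subset_mset.le_iff_add)
  have "size (profile P) \<le> triangle n" using size_profile_le[of P] P(1) by simp
  then have "size K \<le> 1" using K M(2) by simp
  then consider "size K = 0" | "size K = 1" by linarith
  then show "M \<in> ?A \<union> ?B"
  proof cases
    case 1
    then have "M = profile P" using K by simp
    then show ?thesis using profile_second[OF P(1)] M(2) by (force simp: nonadjacent_pairs_def)
  next
    case 2
    then obtain x where x: "K = {#x#}" using size_1_singleton_mset by blast
    have g: "profile P = generic_profile n" using profile_top[OF P(1)] K 2 M(2) by simp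
    then have gx: "generic_profile n = add_mset x M" using K x by simp
    then have "x \<in># generic_profile n" by simp
    then obtain j where "j < n" "x = {j}" by (auto simp: set_mset_generic_profile)
    moreover have "M = generic_profile n - {#x#}" using gx by simp
    ultimately show ?thesis by blast
  qed
next
  fix M assume "M \<in> ?A \<union> ?B"
  then consider j where "j < n" "M = generic_profile n - {#{j}#}"
    | i j where "i + 2 \<le> j" "j < n" "M = coincidence_profile n i j"
    by (auto simp: nonadjacent_pairs_def)
  then show "M \<in> ?L"
  proof cases
    case 1
    then have "generic_profile n = add_mset {j} M" using singleton_in_generic_profile by simp
    then have "size M + 1 = triangle n" using size_generic_profile[of n] by simp
    moreover have "M \<in> realizable n"
      using ex_generic_profile[of n] 1 diff_subset_eq_self by (force simp: realizable_def)
    ultimately show ?thesis by simp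
  next
    case 2
    then show ?thesis
      using ex_coincidence_profile[OF 2(1,2)] size_coincidence_profile[of i j n]
      by (auto simp: realizable_def)
  qed
qed

section \<open>Counting dope matrices by their nonzero rows\<close>

text \<open>
  Dope matrices as lists of rows, each row given by its set of ones; this allows counting by means of
  permutations of multisets.
\<close>

definition row_lists :: "nat \<Rightarrow> nat \<Rightarrow> nat set list set" where
  "row_lists m n =
     {map (zero_orders P) \<Lambda> | P \<Lambda>. P \<noteq> 0 \<and> degree P = n \<and> length \<Lambda> = m \<and> distinct \<Lambda>}"

definition mat_of_rows01 :: "nat \<Rightarrow> nat set list \<Rightarrow> nat mat" where
  "mat_of_rows01 n xs = mat (length xs) (n + 1) (\<lambda>(i, j). if j \<in> xs ! i then 1 else 0)"

lemma dope_matrix_eq: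
  assumes "P \<noteq> 0" "degree P = n"
  shows "dope_matrix P \<Lambda> = mat_of_rows01 n (map (zero_orders P) \<Lambda>)"
proof -
  have "poly ((pderiv ^^ j) P) z = 0 \<longleftrightarrow> j \<in> zero_orders P z" if "j < n + 1" for j z
  proof (cases "j = n")
    case True
    then show ?thesis using higher_pderiv_degree_const[OF assms(1)] assms(2)
      by (auto simp: zero_orders_def)
  next
    case False
    then show ?thesis using that assms(2) by (simp add: zero_orders_def)
  qed
  then show ?thesis
    unfolding dope_matrix_def mat_of_rows01_def by (intro eq_matI) (auto simp: assms(2))
qed

lemma row_lists_elem:
  assumes "xs \<in> row_lists m n" "i < m"
  shows "xs ! i \<subseteq> {..<n}"
  using assms subsetD[OF zero_orders_subset] by (auto simp: row_lists_def)

lemma length_row_lists: "xs \<in> row_lists m n \<Longrightarrow> length xs = m"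
  by (auto simp: row_lists_def)

lemma inj_on_mat_of_rows01: "inj_on (mat_of_rows01 n) (row_lists m n)"
proof (rule inj_onI)
  fix xs ys
  assume xs: "xs \<in> row_lists m n" and ys: "ys \<in> row_lists m n"
    and eq: "mat_of_rows01 n xs = mat_of_rows01 n ys"
  have row: "zs ! i = {j. j < n \<and> mat_of_rows01 n zs $$ (i, j) = 1}"
    if "zs \<in> row_lists m n" "i < m" for zs i
    using row_lists_elem[OF that] length_row_lists[OF that(1)] that(2)
    by (auto simp: mat_of_rows01_def split: if_splits)
  show "xs = ys"
  proof (rule nth_equalityI)
    fix i assume "i < length xs"
    then have "i < m" using length_row_lists[OF xs] by simp
    then show "xs ! i = ys ! i" using row[OF xs] row[OF ys] eq by simp
  qed (use length_row_lists xs ys in auto)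
qed

lemma card_dope_matrices_eq_card_row_lists: "card (dope_matrices m n) = card (row_lists m n)"
proof -
  have "dope_matrices m n = mat_of_rows01 n ` row_lists m n"
    unfolding dope_matrices_def row_lists_def using dope_matrix_eq
    by (auto simp: image_iff) metis+
  then show ?thesis using card_image[OF inj_on_mat_of_rows01] by metis
qed

lemma ex_distinct_preimage:
  assumes "mset xs = image_mset f (mset_set A)" "finite A"
  shows "\<exists>ys. distinct ys \<and> set ys = A \<and> map f ys = xs"
  using assms
proof (induction xs arbitrary: A)
  case Nil
  then show ?case by (simp add: mset_set_empty_iff)
next
  case (Cons x xs)
  then have "x \<in># image_mset f (mset_set A)" by (metis list.set_intros(1) set_mset_mset)
  then obtain a where a: "a \<in> A" "x = f a" using Cons.prems(2) by auto
  have "mset xs = image_mset f (mset_set (A - {a}))"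
    using Cons.prems a by (simp add: mset_set.remove)
  then obtain ys where "distinct ys" "set ys = A - {a}" "map f ys = xs"
    using Cons.IH Cons.prems(2) by blast
  then show ?case using a by (intro exI[of _ "a # ys"]) auto
qed

lemma sub_mset_set_eq:
  assumes "B \<subseteq># mset_set Z"
  shows "B = mset_set (set_mset B)"
proof (rule multiset_eqI)
  fix x
  have "count B x \<le> count (mset_set Z) x" using assms by (simp add: mset_subset_eq_count)
  also have "\<dots> \<le> 1" by (cases "finite Z \<and> x \<in> Z") auto
  finally have "count B x \<le> 1" .
  then show "count B x = count (mset_set (set_mset B)) x"
  proof (cases "x \<in># B")
    case True
    then have "count B x \<noteq> 0" by (simp add: count_eq_zero_iff)
    then have "count B x = 1" using \<open>count B x \<le> 1\<close> by linarith
    then show ?thesis using True by simp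
  qed (simp add: not_in_iff)
qed

lemma mset_split_empty_rows:
  "M = {#x \<in># M. x \<noteq> {}#} + replicate_mset (size M - size {#x \<in># M. x \<noteq> {}#}) {}"
proof -
  have p: "M = {#x \<in># M. x \<noteq> {}#} + replicate_mset (count M {}) {}"
    using multiset_partition[of M "\<lambda>x. x \<noteq> {}"] by (simp add: filter_eq_replicate_mset)
  then have "size M = size {#x \<in># M. x \<noteq> {}#} + count M {}"
    by (metis size_union size_replicate_mset)
  then show ?thesis using p by simp
qed

abbreviation nonempty_rows :: "nat set multiset \<Rightarrow> nat set multiset" where
  "nonempty_rows M \<equiv> {#x \<in># M. x \<noteq> {}#}"

text \<open>
  All but finitely many points contribute zero rows, so a list of rows is attained as soon as its
  nonempty rows form a submultiset of a profile.
\<close>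

lemma row_lists_iff:
  "xs \<in> row_lists m n \<longleftrightarrow> length xs = m \<and> nonempty_rows (mset xs) \<in> realizable n"
proof (intro iffI conjI)
  assume "xs \<in> row_lists m n"
  then obtain P \<Lambda> where P: "P \<noteq> 0" "degree P = n" "length \<Lambda> = m" "distinct \<Lambda>"
    "xs = map (zero_orders P) \<Lambda>" by (auto simp: row_lists_def)
  show "length xs = m" using P by simp
  have "mset xs = image_mset (zero_orders P) (mset_set (set \<Lambda>))"
    using P by (simp add: mset_set_set)
  then have "nonempty_rows (mset xs) =
      image_mset (zero_orders P) (mset_set {z \<in> set \<Lambda>. zero_orders P z \<noteq> {}})"
    by (simp add: filter_mset_image_mset)
  also have "\<dots> \<subseteq># profile P"
    unfolding profile_def
    by (intro image_mset_subseteq_mono subset_imp_msubset_mset_set finite_critical) auto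
  finally show "nonempty_rows (mset xs) \<in> realizable n"
    using P by (auto simp: realizable_def)
next
  assume *: "length xs = m \<and> nonempty_rows (mset xs) \<in> realizable n"
  let ?M = "nonempty_rows (mset xs)"
  obtain P where P: "P \<noteq> 0" "degree P = n" "?M \<subseteq># profile P"
    using * by (auto simp: realizable_def)
  let ?Z = "{z. zero_orders P z \<noteq> {}}"
  obtain K where "image_mset (zero_orders P) (mset_set ?Z) = ?M + K"
    using P(3) unfolding profile_def by (metis subset_mset.le_iff_add)
  from image_mset_eq_plusD[OF this] obtain B C where
    B: "mset_set ?Z = B + C" "?M = image_mset (zero_orders P) B" by blast
  have BZ: "B \<subseteq># mset_set ?Z" using B(1) by simp
  define A where "A = set_mset B"
  have A: "A \<subseteq> ?Z" using set_mset_mono[OF BZ] finite_critical[of P] by (simp add: A_def)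
  have MA: "?M = image_mset (zero_orders P) (mset_set A)"
    using B(2) sub_mset_set_eq[OF BZ] by (simp add: A_def)
  \<comment> \<open>The points in \<open>A\<close> supply the nonempty rows, those in \<open>E\<close> the empty ones.\<close>
  have "infinite (- ?Z)" using finite_critical[of P] infinite_UNIV_char_0 by (simp add: finite_compl Compl_eq_Diff_UNIV)
  then obtain E where E: "finite E" "card E = m - size ?M" "E \<subseteq> - ?Z"
    using infinite_arbitrarily_large by metis
  have "image_mset (zero_orders P) (mset_set E) = image_mset (\<lambda>_. {}) (mset_set E)"
    using E by (intro image_mset_cong) auto
  also have "\<dots> = replicate_mset (m - size ?M) {}"
    using E(2) by (simp add: image_mset_const_eq)
  finally have ME: "image_mset (zero_orders P) (mset_set E) = replicate_mset (m - size ?M) {}" .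
  have fin: "finite A" "finite E" using E by (simp_all add: A_def)
  have "A \<inter> E = {}" using A E(3) by blast
  then have "image_mset (zero_orders P) (mset_set (A \<union> E)) = ?M + replicate_mset (m - size ?M) {}"
    using MA ME fin by (simp add: mset_set_Union)
  also have "\<dots> = mset xs" using mset_split_empty_rows[of "mset xs"] * by simp
  finally obtain ys where "distinct ys" "map (zero_orders P) ys = xs"
    using ex_distinct_preimage[of xs "zero_orders P" "A \<union> E"] fin by auto
  then show "xs \<in> row_lists m n" using P(1,2) * unfolding row_lists_def by force
qed

text \<open>
  The multinomial coefficient of the multiplicities of \<open>M\<close>.
\<close>

definition arrangements :: "'a multiset \<Rightarrow> nat" where
  "arrangements M = card (permutations_of_multiset M)"

lemma arrangements_pad:
  assumes "x \<notin># M"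
  shows "arrangements (M + replicate_mset k x) = (size M + k choose k) * arrangements M"
proof (induction k)
  case (Suc k)
  let ?A = "M + replicate_mset k x"
  have "count M x = 0" using assms by (simp add: count_eq_zero_iff)
  then have "arrangements (M + replicate_mset (Suc k) x) * Suc k = Suc (size M + k) * arrangements ?A"
    using card_permutations_of_multiset_insert_aux[of ?A x] by (simp add: arrangements_def)
  also have "\<dots> = Suc (size M + k) * (size M + k choose k) * arrangements M"
    by (simp only: Suc.IH mult.assoc)
  also have "\<dots> = (size M + Suc k choose Suc k) * arrangements M * Suc k"
    unfolding Suc_times_binomial[of k "size M + k", symmetric] by (simp only: add_Suc_right mult_ac)
  finally show ?case by (simp only: mult_right_cancel)
qed simp

text \<open>
  Sorting the dope matrices by the multiset \<open>M\<close> of their nonzero rows: there are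
  \<open>m choose size M\<close> positions for these rows and \<open>arrangements M\<close> ways to order them. Since the index
  set depends on \<open>n\<close> alone, the count is a polynomial in \<open>m\<close>, whose leading coefficients in the basis
  of binomial coefficients are governed by the largest realizable multisets.
\<close>

theorem card_dope_matrices:
  "card (dope_matrices m n) = (\<Sum>M\<in>realizable n. arrangements M * (m choose size M))"
proof -
  let ?R = "{M \<in> realizable n. size M \<le> m}"
  let ?pad = "\<lambda>M. M + replicate_mset (m - size M) ({} :: nat set)"
  have nonempty: "{} \<notin># M" if "M \<in> realizable n" for M
    using realizable_elem[OF that] by blast
  have pad: "nonempty_rows (?pad M) = M" if "M \<in> realizable n" for M
  proof -
    have "nonempty_rows M = {#x \<in># M. True#}"
      using nonempty[OF that] by (intro filter_mset_cong) auto
    moreover have "nonempty_rows (replicate_mset k {}) = {#}" for k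
      by (induction k) auto
    ultimately show ?thesis by simp
  qed
  have "row_lists m n = (\<Union>M\<in>?R. permutations_of_multiset (?pad M))"
  proof (intro equalityI subsetI)
    fix xs assume xs: "xs \<in> row_lists m n"
    let ?M = "nonempty_rows (mset xs)"
    have m: "length xs = m" and M: "?M \<in> realizable n" using xs by (simp_all add: row_lists_iff)
    have "size ?M \<le> m" using m by (metis size_filter_mset_lesseq size_mset)
    moreover have "mset xs = ?pad ?M" using mset_split_empty_rows[of "mset xs"] m by simp
    ultimately show "xs \<in> (\<Union>M\<in>?R. permutations_of_multiset (?pad M))"
      using M by (auto simp: permutations_of_multiset_def)
  next
    fix xs assume "xs \<in> (\<Union>M\<in>?R. permutations_of_multiset (?pad M))"
    then obtain M where M: "M \<in> realizable n" "size M \<le> m" "mset xs = ?pad M"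
      by (auto simp: permutations_of_multiset_def)
    have "length xs = m" using M(2) arg_cong[OF M(3), of size] by simp
    then show "xs \<in> row_lists m n" using M pad by (simp add: row_lists_iff)
  qed
  then have "card (row_lists m n) = (\<Sum>M\<in>?R. arrangements (?pad M))"
  proof -
    have disj: "permutations_of_multiset (?pad M) \<inter> permutations_of_multiset (?pad M') = {}"
      if "M \<in> ?R" "M' \<in> ?R" "M \<noteq> M'" for M M'
    proof -
      have "?pad M \<noteq> ?pad M'" using pad that by (metis (no_types, lifting) mem_Collect_eq)
      then show ?thesis by (auto simp: permutations_of_multiset_def)
    qed
    have "finite ?R" using finite_realizable by simp
    then have "card (\<Union>M\<in>?R. permutations_of_multiset (?pad M)) = (\<Sum>M\<in>?R. arrangements (?pad M))"
      unfolding arrangements_def using disj by (subst card_UN_disjoint) auto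
    then show ?thesis
      using \<open>row_lists m n = (\<Union>M\<in>?R. permutations_of_multiset (?pad M))\<close> by simp
  qed
  also have "\<dots> = (\<Sum>M\<in>?R. arrangements M * (m choose size M))"
  proof (rule sum.cong[OF refl])
    fix M assume M: "M \<in> ?R"
    then have "arrangements (?pad M) = (m choose (m - size M)) * arrangements M"
      using arrangements_pad[OF nonempty] by simp
    then show "arrangements (?pad M) = arrangements M * (m choose size M)"
      using M binomial_symmetric[of "size M" m] by simp
  qed
  also have "\<dots> = (\<Sum>M\<in>realizable n. arrangements M * (m choose size M))"
    using finite_realizable by (intro sum.mono_neutral_left) (auto simp: binomial_eq_0)
  finally show ?thesis by (simp add: card_dope_matrices_eq_card_row_lists)
qed

section \<open>The two leading coefficients\<close>

lemma prod_fact_reversed: "(\<Prod>j<n. fact (n - j)) = (\<Prod>k=1..n. fact k :: nat)"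
  by (rule prod.reindex_bij_witness[of _ "\<lambda>k. n - k" "\<lambda>j. n - j"]) auto

lemma prod_fact_generic_profile:
  "(\<Prod>x\<in>set_mset (generic_profile n). fact (count (generic_profile n) x)) =
     (\<Prod>k=1..n. fact k :: nat)"
proof -
  have "(\<Prod>x\<in>set_mset (generic_profile n). fact (count (generic_profile n) x)) =
      (\<Prod>j<n. fact (n - j) :: nat)"
    unfolding set_mset_generic_profile
    by (subst prod.reindex) (auto simp: inj_on_def count_generic_profile)
  also have "\<dots> = (\<Prod>k=1..n. fact k)" by (rule prod_fact_reversed)
  finally show ?thesis .
qed

lemma arrangements_generic_profile:
  "real (arrangements (generic_profile n)) = fact (triangle n) / (\<Prod>k=1..n. fact k)"
proof -
  have "arrangements (generic_profile n) * (\<Prod>k=1..n. fact k) = fact (triangle n)"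
    using card_permutations_of_multiset_aux[of "generic_profile n"]
    by (simp add: arrangements_def prod_fact_generic_profile size_generic_profile)
  from arg_cong[OF this, of real]
  have "real (arrangements (generic_profile n)) * (\<Prod>k=1..n. fact k) = fact (triangle n)"
    by (simp add: of_nat_prod)
  then show ?thesis by (simp add: eq_divide_eq)
qed

lemma arrangements_remove:
  assumes "x \<in># M"
  shows "real (arrangements (M - {#x#})) * real (size M) = real (arrangements M) * real (count M x)"
  using arg_cong[OF card_permutations_of_multiset_remove_aux[OF assms], of real]
  by (simp add: arrangements_def mult.commute)

lemma arrangements_generic_minus_row:
  assumes "j < n"
  shows "real (arrangements (generic_profile n - {#{j}#})) * real (triangle n) =
    real (arrangements (generic_profile n)) * real (n - j)"
  using arrangements_remove[OF singleton_in_generic_profile[OF assms]]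
  by (simp add: size_generic_profile count_generic_profile)

text \<open>
  Removing \<open>{j}\<close> and then \<open>{i}\<close> from the generic profile divides the multinomial coefficient in the
  usual way, and adding the new row \<open>{i, j}\<close>, which has multiplicity one, undoes the division by the
  number of rows in the second step.
\<close>

lemma arrangements_coincidence_profile:
  assumes ij: "i < j" "j < n"
  shows "real (arrangements (coincidence_profile n i j)) * real (triangle n) =
    real (arrangements (generic_profile n)) * real (n - i) * real (n - j)"
proof -
  let ?G = "generic_profile n - {#{j}#}"
  let ?B = "?G - {#{i}#}"
  have i: "{i} \<in># ?G" using ij by (simp add: in_diff_count count_generic_profile)
  have B: "coincidence_profile n i j = ?B + {#{i, j}#}"
    by (simp add: coincidence_profile_def diff_diff_add_mset add_mset_commute)
  have "{i, j} \<notin># generic_profile n" using ij by (auto simp: set_mset_generic_profile)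
  then have c0: "count ?B {i, j} = 0"
    by (metis count_eq_zero_iff in_diffD)
  have "arrangements (?B + {#{i, j}#}) = (size ?B + 1) * arrangements ?B"
    using card_permutations_of_multiset_insert_aux[of ?B "{i, j}"] unfolding c0
    by (simp add: arrangements_def)
  moreover have "size ?B + 1 = size ?G" using i by (metis Suc_eq_plus1 insert_DiffM size_add_mset)
  ultimately have "arrangements (?B + {#{i, j}#}) = arrangements ?B * size ?G"
    by (simp only: mult.commute)
  then have "real (arrangements (coincidence_profile n i j)) =
      real (arrangements ?B) * real (size ?G)" unfolding B by (simp only: of_nat_mult)
  also have "\<dots> = real (arrangements ?G) * real (n - i)"
    using arrangements_remove[OF i] ij by (simp add: count_generic_profile)
  finally show ?thesis using arrangements_generic_minus_row[OF ij(2)] by (simp add: algebra_simps)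
qed

lemma inj_on_coincidence_profile:
  "inj_on (\<lambda>(i, j). coincidence_profile n i j) (nonadjacent_pairs n)"
proof -
  have pair: "{x \<in> set_mset (coincidence_profile n i j). \<forall>k. x \<noteq> {k}} = {{i, j}}"
    if "i < j" for i j
    using that set_mset_generic_profile[of n] by (auto simp: coincidence_profile_def dest!: in_diffD)
  show ?thesis
  proof (rule inj_onI, clarify)
    fix i j i' j'
    assume "(i, j) \<in> nonadjacent_pairs n" "(i', j') \<in> nonadjacent_pairs n"
      and eq: "coincidence_profile n i j = coincidence_profile n i' j'"
    then have lt: "i < j" "i' < j'" by (auto simp: nonadjacent_pairs_def)
    have "{i, j} = {i', j'}" using pair[OF lt(1)] pair[OF lt(2)] eq by simp
    then show "i = i' \<and> j = j'" using lt by (auto simp: doubleton_eq_iff)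
  qed
qed

lemma finite_nonadjacent_pairs [simp]: "finite (nonadjacent_pairs n)"
  by (rule finite_subset[of _ "{..<n} \<times> {..<n}"]) (auto simp: nonadjacent_pairs_def)

text \<open>
  Passing from \<open>n\<close> to \<open>n + 1\<close>, the pairs with \<open>i > 0\<close> are the shifts of the old pairs and contribute
  the same terms; those with \<open>i = 0\<close> contribute \<open>n + 1\<close> times a sum of consecutive integers.
\<close>

lemma sum_nonadjacent_pairs:
  "(\<Sum>(i, j)\<in>nonadjacent_pairs n. real (n - i) * real (n - j)) =
     real (triangle n) * ((real n - 1) * (real n - 2) / 4)"
proof (induction n)
  case 0
  then show ?case by (simp add: nonadjacent_pairs_def triangle_def)
next
  case (Suc n)
  let ?f = "\<lambda>(i, j). real (Suc n - i) * real (Suc n - j)"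
  let ?S = "\<lambda>(i, j). (Suc i, Suc j)"
  have split: "nonadjacent_pairs (Suc n) =
      (\<lambda>k. (0, Suc (Suc k))) ` {..<n - 1} \<union> ?S ` nonadjacent_pairs n"
  proof (intro equalityI subsetI)
    fix p assume p: "p \<in> nonadjacent_pairs (Suc n)"
    obtain i j where ij: "p = (i, j)" "i + 2 \<le> j" "j < Suc n"
      using p by (auto simp: nonadjacent_pairs_def)
    show "p \<in> (\<lambda>k. (0, Suc (Suc k))) ` {..<n - 1} \<union> ?S ` nonadjacent_pairs n"
    proof (cases i)
      case 0
      then have "p = (\<lambda>k. (0, Suc (Suc k))) (j - 2)" "j - 2 < n - 1" using ij by auto
      then show ?thesis by blast
    next
      case (Suc i')
      then have "p = ?S (i', j - 1)" "(i', j - 1) \<in> nonadjacent_pairs n"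
        using ij by (auto simp: nonadjacent_pairs_def)
      then show ?thesis by blast
    qed
  qed (auto simp: nonadjacent_pairs_def)
  have "sum ?f (nonadjacent_pairs (Suc n)) =
      sum ?f ((\<lambda>k. (0, Suc (Suc k))) ` {..<n - 1}) + sum ?f (?S ` nonadjacent_pairs n)"
    unfolding split by (rule sum.union_disjoint) auto
  also have "sum ?f ((\<lambda>k. (0, Suc (Suc k))) ` {..<n - 1}) =
      real (Suc n) * (\<Sum>k<n - 1. real (n - 1 - k))"
    by (subst sum.reindex) (auto simp: inj_on_def sum_distrib_left intro!: sum.cong)
  also have "(\<Sum>k<n - 1. real (n - 1 - k)) = real (triangle (n - 1))"
    using arg_cong[OF sum_diff_eq_triangle[of "n - 1"], of real] by simp
  also have "sum ?f (?S ` nonadjacent_pairs n) =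
      (\<Sum>(i, j)\<in>nonadjacent_pairs n. real (n - i) * real (n - j))"
    by (subst sum.reindex) (auto simp: inj_on_def intro!: sum.cong)
  also note Suc.IH
  finally have eq: "sum ?f (nonadjacent_pairs (Suc n)) = real (Suc n) * real (triangle (n - 1)) +
      real (triangle n) * ((real n - 1) * (real n - 2) / 4)" .
  show ?case
  proof (cases n)
    case 0
    then show ?thesis using eq by (simp add: triangle_def)
  next
    case (Suc k)
    then show ?thesis using eq by (simp add: real_triangle field_simps)
  qed
qed

text \<open>
  The summand 1 on the right comes from the generic profile with one row left out, the other summand
  from the profiles with one coincidence.
\<close>

lemma sum_arrangements_second:
  assumes "n > 0"
  shows "(\<Sum>M | M \<in> realizable n \<and> size M + 1 = triangle n. real (arrangements M)) =
    real (arrangements (generic_profile n)) * (1 + (real n - 1) * (real n - 2) / 4)"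
proof -
  let ?G = "generic_profile n" and ?T = "real (triangle n)"
  let ?A = "(\<lambda>j. ?G - {#{j}#}) ` {..<n}"
  let ?B = "(\<lambda>(i, j). coincidence_profile n i j) ` nonadjacent_pairs n"
  have T: "?T > 0" using assms by (simp add: real_triangle)
  have "?A \<inter> ?B = {}"
  proof -
    have "{i, j} \<notin># ?G - {#{k}#}" if "i + 2 \<le> j" for i j k
      using that set_mset_generic_profile[of n] by (auto dest!: in_diffD)
    moreover have "{i, j} \<in># coincidence_profile n i j" for i j by (simp add: coincidence_profile_def)
    ultimately have "generic_profile n - {#{k}#} \<noteq> coincidence_profile n i j" if "i + 2 \<le> j" for i j k
      using that by metis
    then show ?thesis by (auto simp: nonadjacent_pairs_def)
  qed
  then have "(\<Sum>M | M \<in> realizable n \<and> size M + 1 = triangle n. real (arrangements M)) =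
      (\<Sum>M\<in>?A. real (arrangements M)) + (\<Sum>M\<in>?B. real (arrangements M))"
    unfolding realizable_second by (intro sum.union_disjoint) auto
  also have "(\<Sum>M\<in>?A. real (arrangements M)) = (\<Sum>j<n. real (arrangements (?G - {#{j}#})))"
  proof (rule sum.reindex_cong[OF _ refl refl])
    show "inj_on (\<lambda>j. ?G - {#{j}#}) {..<n}"
    proof (rule inj_onI)
      fix j k assume jk: "j \<in> {..<n}" "k \<in> {..<n}" "?G - {#{j}#} = ?G - {#{k}#}"
      have "add_mset l (?G - {#l#}) = ?G" if "l \<in># ?G" for l using that by simp
      then have "add_mset {j} (?G - {#{j}#}) = add_mset {k} (?G - {#{k}#})"
        using jk(1,2) singleton_in_generic_profile[of _ n] by (metis lessThan_iff)
      then have "add_mset {j} (?G - {#{k}#}) = add_mset {k} (?G - {#{k}#})"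
        by (simp only: jk(3))
      then show "j = k" by simp
    qed
  qed
  also have "\<dots> = (\<Sum>j<n. real (arrangements ?G) * real (n - j) / ?T)"
  proof (rule sum.cong[OF refl])
    fix j assume "j \<in> {..<n}"
    then show "real (arrangements (?G - {#{j}#})) = real (arrangements ?G) * real (n - j) / ?T"
      using arrangements_generic_minus_row[of j n] T by (simp add: eq_divide_eq)
  qed
  also have "\<dots> = real (arrangements ?G) * real (\<Sum>j<n. n - j) / ?T"
    by (simp add: sum_distrib_left sum_divide_distrib)
  also have "\<dots> = real (arrangements ?G)" using T by (simp only: sum_diff_eq_triangle) simp
  also have "(\<Sum>M\<in>?B. real (arrangements M)) =
      (\<Sum>(i, j)\<in>nonadjacent_pairs n. real (arrangements (coincidence_profile n i j)))"
    by (subst sum.reindex[OF inj_on_coincidence_profile]) (simp add: case_prod_unfold)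
  also have "\<dots> = (\<Sum>(i, j)\<in>nonadjacent_pairs n.
      real (arrangements ?G) / ?T * (real (n - i) * real (n - j)))"
  proof (rule sum.cong[OF refl], clarify)
    fix i j assume "(i, j) \<in> nonadjacent_pairs n"
    then have "real (arrangements (coincidence_profile n i j)) * ?T =
        real (arrangements ?G) * real (n - i) * real (n - j)"
      using arrangements_coincidence_profile[of i j n] by (simp add: nonadjacent_pairs_def)
    then show "real (arrangements (coincidence_profile n i j)) =
        real (arrangements ?G) / ?T * (real (n - i) * real (n - j))"
      using T by (simp add: eq_divide_eq mult.assoc)
  qed
  also have "\<dots> = real (arrangements ?G) / ?T *
      (\<Sum>(i, j)\<in>nonadjacent_pairs n. real (n - i) * real (n - j))"
    by (simp add: sum_distrib_left case_prod_unfold)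
  also have "\<dots> = real (arrangements ?G) * ((real n - 1) * (real n - 2) / 4)"
    using T by (simp add: sum_nonadjacent_pairs)
  finally show ?thesis by (simp add: algebra_simps)
qed

section \<open>Upper and lower bounds\<close>

lemma binomial_mult_fact_le:
  assumes "i \<le> k" "k \<le> m"
  shows "(m choose i) * fact k \<le> m ^ k"
  using assms
proof (induction k rule: dec_induct)
  case base
  show ?case by (rule binomial_fact_pow)
next
  case (step k)
  have "(m choose i) * fact (Suc k) = Suc k * ((m choose i) * fact k)" by (simp add: algebra_simps)
  also have "\<dots> \<le> m * m ^ k" using step by (intro mult_le_mono) auto
  finally show ?case by simp
qed

lemma card_small_subsets_le:
  assumes "k \<le> m"
  shows "card {S. S \<subseteq> {..<m} \<and> card S \<le> k} * fact k \<le> (k + 1) * m ^ k"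
proof -
  have "{S. S \<subseteq> {..<m} \<and> card S \<le> k} = (\<Union>i\<le>k. {S. S \<subseteq> {..<m} \<and> card S = i})" by auto
  then have "card {S. S \<subseteq> {..<m} \<and> card S \<le> k} \<le> (\<Sum>i\<le>k. m choose i)"
    using card_UN_le[of "{..k}" "\<lambda>i. {S. S \<subseteq> {..<m} \<and> card S = i}"] by (simp add: n_subsets)
  then have "card {S. S \<subseteq> {..<m} \<and> card S \<le> k} * fact k \<le> (\<Sum>i\<le>k. m choose i) * fact k"
    by (rule mult_le_mono1)
  also have "\<dots> = (\<Sum>i\<le>k. (m choose i) * fact k)" by (rule sum_distrib_right)
  also have "\<dots> \<le> (\<Sum>i\<le>k. m ^ k)"
    using assms by (intro sum_mono binomial_mult_fact_le) auto
  finally show ?thesis by simp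
qed

lemma card_column_le:
  assumes "xs \<in> row_lists m n"
  shows "card {i. i < m \<and> j \<in> xs ! i} \<le> n - j"
proof -
  obtain P \<Lambda> where P: "degree P = n" "length \<Lambda> = m" "distinct \<Lambda>" "xs = map (zero_orders P) \<Lambda>"
    using assms by (auto simp: row_lists_def)
  let ?C = "{i. i < m \<and> j \<in> xs ! i}"
  have "inj_on ((!) \<Lambda>) ?C" using P by (auto intro: inj_on_nth)
  moreover have "(!) \<Lambda> ` ?C \<subseteq> {z. j \<in> zero_orders P z}" using P by auto
  ultimately have "card ?C \<le> card {z. j \<in> zero_orders P z}"
    by (rule card_inj_on_le[OF _ _ finite_order_zeros])
  then show ?thesis using card_order_zeros_le[of j P] P(1) by simp
qed

text \<open>
  A matrix is determined by its columns, and column \<open>j\<close> is a set of at most \<open>n - j\<close> of the \<open>m\<close>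
  positions. The factorials make this bound agree with the lower bound from the generic profile
  up to a factor \<open>exp (O(n\<^sup>2))\<close> when \<open>m\<close> has order \<open>n\<^sup>2\<close>.
\<close>

lemma card_dope_matrices_le:
  assumes "n \<le> m"
  shows "card (dope_matrices m n) * (\<Prod>k=1..n. fact k) \<le> fact (n + 1) * m ^ triangle n"
proof -
  let ?F = "\<lambda>j. {S. S \<subseteq> {..<m} \<and> card S \<le> n - j}"
  let ?cols = "\<lambda>xs. \<lambda>j\<in>{..<n}. {i. i < m \<and> j \<in> xs ! i}"
  have fin: "finite (?F j)" for j by (rule finite_subset[of _ "Pow {..<m}"]) auto
  have "inj_on ?cols (row_lists m n)"
  proof (rule inj_onI)
    fix xs ys
    assume xs: "xs \<in> row_lists m n" and ys: "ys \<in> row_lists m n" and eq: "?cols xs = ?cols ys"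
    have row: "j \<in> xs ! i \<longleftrightarrow> j \<in> ys ! i" if "i < m" "j < n" for i j
      using fun_cong[OF eq, of j] that by auto
    show "xs = ys"
    proof (rule nth_equalityI)
      fix i assume "i < length xs"
      then have i: "i < m" using length_row_lists[OF xs] by simp
      show "xs ! i = ys ! i"
        using row[OF i] row_lists_elem[OF xs i] row_lists_elem[OF ys i] by blast
    qed (use length_row_lists xs ys in auto)
  qed
  moreover have "?cols ` row_lists m n \<subseteq> PiE {..<n} ?F"
    using card_column_le by (auto simp: PiE_iff)
  ultimately have "card (row_lists m n) \<le> card (PiE {..<n} ?F)"
    using fin by (intro card_inj_on_le) (auto intro: finite_PiE)
  then have "card (dope_matrices m n) \<le> (\<Prod>j<n. card (?F j))"
    by (simp add: card_dope_matrices_eq_card_row_lists card_PiE)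
  moreover have "(\<Prod>k=1..n. fact k) = (\<Prod>j<n. fact (n - j) :: nat)"
    by (rule prod_fact_reversed[symmetric])
  ultimately have "card (dope_matrices m n) * (\<Prod>k=1..n. fact k) \<le>
      (\<Prod>j<n. card (?F j) * fact (n - j))"
    by (simp add: prod.distrib)
  also have "\<dots> \<le> (\<Prod>j<n. (n - j + 1) * m ^ (n - j))"
    using assms by (intro prod_mono conjI le0 card_small_subsets_le) auto
  also have "\<dots> = (\<Prod>j<n. n - j + 1) * m ^ triangle n"
    by (simp only: prod.distrib sum_diff_eq_triangle flip: power_sum)
  also have "(\<Prod>j<n. n - j + 1) = fact (n + 1)"
    by (induction n) (simp_all add: prod.lessThan_Suc_shift del: prod.lessThan_Suc)
  finally show ?thesis .
qed

lemma arrangements_generic_times_choose_le: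
  "arrangements (generic_profile n) * (m choose triangle n) \<le> card (dope_matrices m n)"
proof -
  have "generic_profile n \<in> realizable n" using realizable_top[of n] by blast
  then show ?thesis
    unfolding card_dope_matrices
    using member_le_sum[of "generic_profile n" "realizable n"
        "\<lambda>M. arrangements M * (m choose size M)"] finite_realizable
    by (simp add: size_generic_profile)
qed

lemma card_dope_matrices_mono: "m \<le> m' \<Longrightarrow> card (dope_matrices m n) \<le> card (dope_matrices m' n)"
  unfolding card_dope_matrices by (intro sum_mono mult_le_mono2 binomial_right_mono)

lemma arrangements_pos: "arrangements M > 0"
  by (simp add: arrangements_def card_gt_0_iff)

lemma power_self_le_exp_mult_fact: "real n ^ n \<le> exp (real n) * fact n"
proof -
  \<comment> \<open>The left-hand side over \<open>fact n\<close> is a single term of the exponential series.\<close>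
  have "summable (\<lambda>k. real n ^ k /\<^sub>R fact k)" "(\<Sum>k. real n ^ k /\<^sub>R fact k) = exp (real n)"
    using exp_converges[of "real n"] by (auto simp: sums_iff)
  then have "real n ^ n /\<^sub>R fact n \<le> exp (real n)"
    using sum_le_suminf[of "\<lambda>k. real n ^ k /\<^sub>R fact k" "{n}"] by simp
  then show ?thesis by (simp add: field_simps)
qed

lemma fact_Suc_le_power: "fact (n + 1) \<le> (n + 1) ^ n"
proof (induction n)
  case (Suc n)
  have "fact (Suc n + 1) = (n + 2) * fact (n + 1)" by simp
  also have "\<dots> \<le> (n + 2) * (n + 1) ^ n" using Suc by (rule mult_le_mono2)
  also have "\<dots> \<le> (n + 2) * (n + 2) ^ n" by (intro mult_le_mono2 power_mono) auto
  finally show ?case by simp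
qed simp

lemma ln_fact_lower:
  assumes "n > 0"
  shows "real n * (ln (real n) - 1) \<le> ln (fact n)"
proof -
  have "ln (real n ^ n) \<le> ln (exp (real n) * fact n)"
    using power_self_le_exp_mult_fact[of n] assms by (subst ln_le_cancel_iff) auto
  then show ?thesis using assms by (simp add: ln_realpow ln_mult algebra_simps)
qed

lemma ln_fact_Suc_upper: "ln (fact (n + 1)) \<le> real n * ln (real n + 1)"
proof -
  have "real (fact (n + 1)) \<le> real ((n + 1) ^ n)" using fact_Suc_le_power of_nat_le_iff by blast
  then have "fact (n + 1) \<le> (real n + 1) ^ n"
    by (simp only: of_nat_fact of_nat_power of_nat_add of_nat_1)
  then have "ln (fact (n + 1)) \<le> ln ((real n + 1) ^ n)" by (subst ln_le_cancel_iff) (auto simp del: fact_Suc)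
  then show ?thesis by (simp add: ln_realpow)
qed

lemma prod_fact_le: "(\<Prod>k=1..n. fact k :: nat) \<le> n ^ triangle n"
proof -
  have "(\<Prod>k=1..n. fact k :: nat) \<le> (\<Prod>k=1..n. n ^ k)"
  proof (rule prod_mono)
    fix k assume "k \<in> {1..n}"
    then have "k ^ k \<le> n ^ k" by (intro power_mono) auto
    moreover have "(fact k :: nat) \<le> k ^ k" using fact_le_power[of k, where 'a = nat] by simp
    ultimately show "0 \<le> (fact k :: nat) \<and> fact k \<le> n ^ k" by simp
  qed
  also have "\<dots> = n ^ (\<Sum>k=1..n. k)" by (rule power_sum[symmetric])
  also have "(\<Sum>k=1..n. k) = triangle n"
    using gauss_sum_from_Suc_0[of n, where 'a = nat] by (simp add: triangle_def power2_eq_square)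
  finally show ?thesis .
qed

lemma le_triangle: "n \<le> triangle n"
  using two_triangle[of n] by (cases n) auto

lemma triangle_le_square: "triangle n \<le> n\<^sup>2"
  using two_triangle[of n] by (cases n) (auto simp: power2_eq_square)

lemma dope_matrices_pos:
  assumes "triangle n \<le> m"
  shows "card (dope_matrices m n) > 0"
  using arrangements_generic_times_choose_le[of n m] arrangements_pos[of "generic_profile n"] assms
  by (metis nat_0_less_mult_iff order_less_le_trans zero_less_binomial_iff)

abbreviation (input) ln_dope :: "nat \<Rightarrow> nat \<Rightarrow> real" where
  "ln_dope m n \<equiv> ln (real (card (dope_matrices m n)))"

abbreviation (input) ln_prod_fact :: "nat \<Rightarrow> real" where
  "ln_prod_fact n \<equiv> ln (\<Prod>k=1..n. fact k)"

lemma ln_dope_upper: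
  assumes "triangle n \<le> m" "0 < n"
  shows "ln_dope m n + ln_prod_fact n \<le> real n * ln (real n + 1) + real (triangle n) * ln (real m)"
proof -
  have nm: "n \<le> m" "0 < m" using le_triangle[of n] assms by auto
  have "real (card (dope_matrices m n) * (\<Prod>k=1..n. fact k)) \<le> real (fact (n + 1) * m ^ triangle n)"
    using card_dope_matrices_le[OF nm(1)] of_nat_le_iff by blast
  then have "real (card (dope_matrices m n)) * (\<Prod>k=1..n. fact k) \<le> fact (n + 1) * real m ^ triangle n"
    by (simp only: of_nat_mult of_nat_prod of_nat_fact of_nat_power)
  moreover have D: "real (card (dope_matrices m n)) > 0" using dope_matrices_pos[OF assms(1)] by simp
  moreover have p: "(\<Prod>k=1..n. fact k :: real) > 0" by (intro prod_pos) auto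
  ultimately have "ln (real (card (dope_matrices m n)) * (\<Prod>k=1..n. fact k)) \<le>
      ln (fact (n + 1) * real m ^ triangle n)"
    using nm by (subst ln_le_cancel_iff) (auto intro!: mult_pos_pos simp del: fact_Suc)
  moreover have "ln (fact (n + 1) * real m ^ triangle n) = ln (fact (n + 1)) + real (triangle n) * ln (real m)"
    using nm by (simp add: ln_mult ln_realpow del: fact_Suc)
  moreover have "ln (real (card (dope_matrices m n)) * (\<Prod>k=1..n. fact k)) = ln_dope m n + ln_prod_fact n"
    using D p by (subst ln_mult) auto
  ultimately show ?thesis using ln_fact_Suc_upper[of n] by linarith
qed

lemma ln_dope_triangle_lower:
  assumes "0 < n"
  shows "real (triangle n) * (ln (real (triangle n)) - 1) \<le> ln_dope (triangle n) n + ln_prod_fact n"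
proof -
  have T: "triangle n > 0" using le_triangle[of n] assms by simp
  have p: "(\<Prod>k=1..n. fact k :: real) > 0" by (intro prod_pos) auto
  have D: "real (card (dope_matrices (triangle n) n)) > 0" using dope_matrices_pos[of n] by simp
  have "real (arrangements (generic_profile n)) \<le> real (card (dope_matrices (triangle n) n))"
    using arrangements_generic_times_choose_le[of n "triangle n"] by simp
  then have "fact (triangle n) \<le> real (card (dope_matrices (triangle n) n)) * (\<Prod>k=1..n. fact k)"
    unfolding arrangements_generic_profile using p by (simp add: divide_le_eq)
  then have "ln (fact (triangle n)) \<le> ln (real (card (dope_matrices (triangle n) n)) * (\<Prod>k=1..n. fact k))"
    using D p by (subst ln_le_cancel_iff) (auto intro!: mult_pos_pos)
  also have "\<dots> = ln_dope (triangle n) n + ln_prod_fact n" using D p by (subst ln_mult) auto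
  finally show ?thesis using ln_fact_lower[OF T] by linarith
qed

lemma ln_prod_fact_nonneg: "0 \<le> ln_prod_fact n"
  by (intro ln_ge_zero prod_ge_1) (auto simp: fact_ge_1)

lemma ln_prod_fact_upper:
  assumes "0 < n"
  shows "ln_prod_fact n \<le> real (triangle n) * ln (real n)"
proof -
  have "real (\<Prod>k=1..n. fact k) \<le> real (n ^ triangle n)" using prod_fact_le of_nat_le_iff by blast
  then have "(\<Prod>k=1..n. fact k) \<le> real n ^ triangle n" by (simp only: of_nat_prod of_nat_fact of_nat_power)
  moreover have p: "(\<Prod>k=1..n. fact k :: real) > 0" by (intro prod_pos) auto
  ultimately have "ln_prod_fact n \<le> ln (real n ^ triangle n)" using assms by (subst ln_le_cancel_iff) auto
  then show ?thesis using assms by (simp add: ln_realpow)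
qed

text \<open>
  In particular \<open>ln_dope (triangle n) n\<close> outgrows \<open>triangle n\<close>, which makes errors of that order
  negligible.
\<close>

lemma ln_dope_triangle_lower':
  assumes "0 < n"
  shows "real (triangle n) * (ln ((real n + 1) / 2) - 1) \<le> ln_dope (triangle n) n"
proof -
  have "real (triangle n) = real n * ((real n + 1) / 2)" by (simp add: real_triangle)
  then have "ln (real (triangle n)) = ln (real n * ((real n + 1) / 2))" by (rule arg_cong)
  also have "\<dots> = ln (real n) + ln ((real n + 1) / 2)" using assms by (subst ln_mult) auto
  finally have "ln (real (triangle n)) = ln (real n) + ln ((real n + 1) / 2)" .
  then show ?thesis
    using ln_dope_triangle_lower[OF assms] ln_prod_fact_upper[OF assms] by (simp add: algebra_simps)
qed

text \<open>
  The terms \<open>ln_prod_fact n\<close> of the upper and of the lower bound cancel.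
\<close>

lemma ln_dope_difference:
  assumes "0 < n" "triangle n \<le> m"
  shows "\<bar>ln_dope m n - ln_dope (triangle n) n\<bar> \<le>
    real (triangle n) * (3 + ln (real m) - ln (real (triangle n)))"
proof -
  have "ln_dope (triangle n) n \<le> ln_dope m n"
    using card_dope_matrices_mono[OF assms(2), of n] dope_matrices_pos[of n] assms(2)
    by (subst ln_le_cancel_iff) auto
  moreover have "real n * ln (real n + 1) \<le> 2 * real (triangle n)"
  proof -
    have "ln (real n + 1) \<le> real n" using ln_add_one_self_le_self[of "real n"] by (simp add: add.commute)
    then have "real n * ln (real n + 1) \<le> real n * (real n + 1)" by (intro mult_left_mono) auto
    then show ?thesis by (simp add: real_triangle)
  qed
  ultimately show ?thesis
    using ln_dope_upper[OF assms(2,1)] ln_dope_triangle_lower[OF assms(1)]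
    by (simp add: algebra_simps)
qed

section \<open>Asymptotics\<close>

lemma asymp_quadratic_range:
  assumes n: "filterlim n at_top sequentially"
    and lt: "\<forall>\<^sub>F t in sequentially. real ((n t)\<^sup>2 + n t) / 2 < real (m t)"
    and Theta: "(\<lambda>t. real (m t)) \<in> O[sequentially](\<lambda>t. real (n t) ^ 2)"
  shows "(\<lambda>t. ln_dope (m t) (n t)) \<sim>[sequentially] (\<lambda>t. ln_dope (triangle (n t)) (n t))"
proof (rule smallo_imp_asymp_equiv, rule landau_o.smallI)
  fix c :: real assume c: "c > 0"
  obtain K where K: "K > 0" "\<forall>\<^sub>F t in sequentially. norm (real (m t)) \<le> K * norm (real (n t) ^ 2)"
    using Theta by (rule landau_o.bigE)
  define C where "C = 3 + ln (2 * K)"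
  have "filterlim (\<lambda>t. real (n t)) at_top sequentially"
    using filterlim_compose[OF filterlim_real_sequentially n] .
  moreover have "filterlim (\<lambda>x. c * (ln ((x + 1) / 2) - 1)) at_top at_top"
    using c by real_asymp
  ultimately have "filterlim (\<lambda>t. c * (ln ((real (n t) + 1) / 2) - 1)) at_top sequentially"
    by (rule filterlim_compose[rotated])
  then have w: "\<forall>\<^sub>F t in sequentially. C \<le> c * (ln ((real (n t) + 1) / 2) - 1)"
    unfolding filterlim_at_top by blast
  have pos: "\<forall>\<^sub>F t in sequentially. 0 < n t" using n eventually_gt_at_top filterlim_iff by metis
  show "\<forall>\<^sub>F t in sequentially. norm (ln_dope (m t) (n t) - ln_dope (triangle (n t)) (n t)) \<le>
      c * norm (ln_dope (triangle (n t)) (n t))"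
    using w pos lt K(2)
  proof eventually_elim
    case (elim t)
    let ?T = "real (triangle (n t))"
    have "real (triangle (n t)) < real (m t)"
      using elim(3) by (simp add: real_triangle power2_eq_square algebra_simps)
    then have Tm: "triangle (n t) \<le> m t" by simp
    have T: "?T > 0" using elim(2) by (simp add: real_triangle)
    \<comment> \<open>Since \<open>m\<close> exceeds \<open>triangle n\<close> by a bounded factor only, the logarithms differ by at most \<open>C\<close> times \<open>triangle n\<close>.\<close>
    have "real (m t) \<le> K * real (n t) ^ 2" using elim(4) by simp
    also have "\<dots> \<le> K * (2 * ?T)"
      using K(1) by (intro mult_left_mono) (auto simp: real_triangle power2_eq_square algebra_simps)
    finally have "real (m t) \<le> 2 * K * ?T" by simp
    moreover have "0 < real (m t)" using Tm T by simp
    ultimately have "ln (real (m t)) \<le> ln (2 * K * ?T)" using K(1) T by (subst ln_le_cancel_iff) auto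
    also have "\<dots> = ln (2 * K) + ln ?T" using K(1) T by (subst ln_mult) auto
    finally have "3 + ln (real (m t)) - ln ?T \<le> C" by (simp add: C_def)
    then have "?T * (3 + ln (real (m t)) - ln ?T) \<le> ?T * (c * (ln ((real (n t) + 1) / 2) - 1))"
      using elim(1) T by (intro mult_left_mono) auto
    also have "\<dots> = c * (?T * (ln ((real (n t) + 1) / 2) - 1))" by (simp only: mult_ac)
    also have "\<dots> \<le> c * ln_dope (triangle (n t)) (n t)"
      using ln_dope_triangle_lower'[OF elim(2)] c by (intro mult_left_mono) auto
    also have "\<dots> \<le> c * norm (ln_dope (triangle (n t)) (n t))"
      using c by (intro mult_left_mono) auto
    finally show ?case using ln_dope_difference[OF elim(2) Tm] by simp
  qed
qed

lemma ln_choose_lower: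
  assumes "0 < n" "triangle n \<le> m"
  shows "real (triangle n) * (ln (real m) - 2 * ln (real n)) \<le> ln (real (m choose triangle n))"
proof -
  let ?T = "triangle n"
  have T: "?T > 0" "m > 0" using le_triangle[of n] assms by auto
  have "(real m / real ?T) ^ ?T \<le> real (m choose ?T)"
    using binomial_ge_n_over_k_pow_k[OF assms(2), where 'a = real] .
  then have "ln ((real m / real ?T) ^ ?T) \<le> ln (real (m choose ?T))"
    using T assms by (subst ln_le_cancel_iff) auto
  moreover have "ln ((real m / real ?T) ^ ?T) = real ?T * (ln (real m) - ln (real ?T))"
    using T by (simp add: ln_realpow ln_div)
  moreover have "ln (real ?T) \<le> 2 * ln (real n)"
  proof -
    have "real ?T \<le> real (n\<^sup>2)" using triangle_le_square of_nat_le_iff by blast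
    then have "ln (real ?T) \<le> ln (real n ^ 2)" using T assms by (subst ln_le_cancel_iff) auto
    then show ?thesis using assms by (simp add: ln_realpow)
  qed
  then have "real ?T * (ln (real m) - 2 * ln (real n)) \<le> real ?T * (ln (real m) - ln (real ?T))"
    by (intro mult_left_mono) auto
  ultimately show ?thesis by linarith
qed

text \<open>
  Both logarithms lie between \<open>T (ln m - 2 ln n)\<close> and \<open>T (ln m + 2 ln n)\<close> with \<open>T = triangle n\<close>.
\<close>

lemma ln_dope_minus_ln_choose:
  assumes "2 \<le> n" "triangle n \<le> m"
  shows "\<bar>ln_dope m n - ln (real (m choose triangle n))\<bar> \<le> 4 * (real (triangle n) * ln (real n))"
proof -
  let ?T = "triangle n"
  have n: "0 < n" using assms by simp
  have "1 * (m choose ?T) \<le> arrangements (generic_profile n) * (m choose ?T)"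
    using arrangements_pos[of "generic_profile n"] by (intro mult_le_mono1) simp
  also have "\<dots> \<le> card (dope_matrices m n)" by (rule arrangements_generic_times_choose_le)
  finally have "real (m choose ?T) \<le> real (card (dope_matrices m n))" by simp
  then have lower: "ln (real (m choose ?T)) \<le> ln_dope m n"
    using assms by (subst ln_le_cancel_iff) (auto simp: dope_matrices_pos)
  have "real n * ln (real n + 1) \<le> 2 * (real ?T * ln (real n))"
  proof -
    have "n + 1 \<le> n\<^sup>2" using assms(1) by (cases n) (auto simp: power2_eq_square)
    then have "real n + 1 \<le> real n ^ 2" by (metis of_nat_1 of_nat_add of_nat_le_iff of_nat_power)
    then have "ln (real n + 1) \<le> ln (real n ^ 2)" using n by (subst ln_le_cancel_iff) auto
    also have "\<dots> = 2 * ln (real n)" using n by (simp add: ln_realpow)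
    finally have "real n * ln (real n + 1) \<le> real ?T * (2 * ln (real n))"
      using le_triangle[of n] n by (intro mult_mono) auto
    then show ?thesis by simp
  qed
  then have "ln_dope m n \<le> real ?T * ln (real m) + 2 * (real ?T * ln (real n))"
    using ln_dope_upper[OF assms(2) n] ln_prod_fact_nonneg[of n] by linarith
  then show ?thesis using lower ln_choose_lower[OF n assms(2)] by (simp add: algebra_simps)
qed

lemma asymp_superpolynomial_range:
  assumes n: "filterlim n at_top sequentially"
    and omega: "(\<lambda>t. ln (real (m t))) \<in> \<omega>[sequentially](\<lambda>t. ln (real (n t)))"
    and pos: "\<forall>\<^sub>F t in sequentially. 0 < m t"
  shows "(\<lambda>t. ln_dope (m t) (n t)) \<sim>[sequentially] (\<lambda>t. ln (real (m t choose triangle (n t))))"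
proof (rule smallo_imp_asymp_equiv, rule landau_o.smallI)
  fix c :: real assume c: "c > 0"
  have ln_ge: "\<forall>\<^sub>F t in sequentially. norm (ln (real (m t))) \<ge> a * norm (ln (real (n t)))" if "a > 0" for a
    using landau_omega.smallD[OF omega that] .
  have n2: "\<forall>\<^sub>F t in sequentially. 2 \<le> n t" using n eventually_ge_at_top filterlim_iff by metis
  \<comment> \<open>\<open>4 x \<le> c (y - 2 x)\<close> amounts to \<open>(4 + 2 c) / c * x \<le> y\<close>; take \<open>x = ln n\<close> and \<open>y = ln m\<close>.\<close>
  have a: "(4 + 2 * c) / c > 0" using c by simp
  show "\<forall>\<^sub>F t in sequentially. norm (ln_dope (m t) (n t) - ln (real (m t choose triangle (n t)))) \<le>
      c * norm (ln (real (m t choose triangle (n t))))"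
    using n2 ln_ge[of 2, simplified] ln_ge[OF a] pos
  proof eventually_elim
    case (elim t)
    let ?T = "real (triangle (n t))"
    have lnn: "ln (real (n t)) \<ge> 0" using elim(1) by simp
    have lnm: "ln (real (m t)) \<ge> 0" using elim(4) by simp
    have ge: "2 * ln (real (n t)) \<le> ln (real (m t))" "(4 + 2 * c) / c * ln (real (n t)) \<le> ln (real (m t))"
      using elim(2,3) lnn lnm by auto
    have "ln (real (n t) ^ 2) \<le> ln (real (m t))" using ge(1) elim(1) by (simp add: ln_realpow)
    then have "real (n t) ^ 2 \<le> real (m t)" using elim(1,4) by (subst (asm) ln_le_cancel_iff) auto
    then have "(n t)\<^sup>2 \<le> m t" by (metis of_nat_le_iff of_nat_power)
    then have Tm: "triangle (n t) \<le> m t" using triangle_le_square[of "n t"] by simp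
    have "4 * ln (real (n t)) \<le> c * (ln (real (m t)) - 2 * ln (real (n t)))"
      using ge(2) c by (simp add: field_simps)
    then have "?T * (4 * ln (real (n t))) \<le> ?T * (c * (ln (real (m t)) - 2 * ln (real (n t))))"
      by (intro mult_left_mono) auto
    then have "4 * (?T * ln (real (n t))) \<le> c * (?T * (ln (real (m t)) - 2 * ln (real (n t))))"
      by (simp only: mult_ac)
    also have "\<dots> \<le> c * ln (real (m t choose triangle (n t)))"
      using ln_choose_lower[of "n t" "m t"] Tm elim(1) c by (intro mult_left_mono) auto
    also have "\<dots> \<le> c * norm (ln (real (m t choose triangle (n t))))"
      using c by (intro mult_left_mono) auto
    finally show ?case using ln_dope_minus_ln_choose[OF elim(1) Tm] by simp
  qed
qed

section \<open>The leading terms for fixed degree\<close>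

lemma ex_poly_choose: "\<exists>p :: real poly. \<forall>m. real (m choose k) = poly p (real m)"
proof
  let ?p = "Polynomial.smult (1 / fact k) (\<Prod>i=0..<k. [:- real i, 1:])"
  show "\<forall>m. real (m choose k) = poly ?p (real m)"
    by (simp add: binomial_gbinomial gbinomial_prod_rev poly_prod)
qed

lemma ex_poly_card_dope_matrices:
  "\<exists>p :: real poly. \<forall>m. real (card (dope_matrices m n)) = poly p (real m)"
proof -
  obtain p :: "nat \<Rightarrow> real poly" where p: "\<And>k m. real (m choose k) = poly (p k) (real m)"
    using ex_poly_choose by metis
  have "real (card (dope_matrices m n)) =
      poly (\<Sum>M\<in>realizable n. Polynomial.smult (real (arrangements M)) (p (size M))) (real m)" for m
    by (simp add: card_dope_matrices poly_sum p)
  then show ?thesis by blast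
qed

lemma card_dope_matrices_two_terms:
  assumes "n > 0"
  shows "real (card (dope_matrices m n)) =
    fact (triangle n) / (\<Prod>k=1..n. fact k) * real (m choose triangle n) +
    fact (triangle n) / (\<Prod>k=1..n. fact k) * (1 + (real n - 1) * (real n - 2) / 4) *
      real (m choose (triangle n - 1)) +
    (\<Sum>M | M \<in> realizable n \<and> size M + 2 \<le> triangle n. real (arrangements M) * real (m choose size M))"
proof -
  let ?R = "realizable n" and ?T = "triangle n"
  let ?f = "\<lambda>M. real (arrangements M) * real (m choose size M)"
  have "?R = {M \<in> ?R. size M = ?T} \<union> {M \<in> ?R. size M + 1 = ?T} \<union> {M \<in> ?R. size M + 2 \<le> ?T}"
    using size_realizable_le[of _ n] by force
  then have "sum ?f ?R = sum ?f ({M \<in> ?R. size M = ?T} \<union> {M \<in> ?R. size M + 1 = ?T} \<union>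
      {M \<in> ?R. size M + 2 \<le> ?T})" by simp
  also have "\<dots> = sum ?f {M \<in> ?R. size M = ?T} + sum ?f {M \<in> ?R. size M + 1 = ?T} +
      sum ?f {M \<in> ?R. size M + 2 \<le> ?T}"
    using finite_realizable[of n] by (subst sum.union_disjoint | auto)+
  also have "sum ?f {M \<in> ?R. size M = ?T} = real (arrangements (generic_profile n)) * real (m choose ?T)"
    by (simp add: realizable_top size_generic_profile)
  also have "sum ?f {M \<in> ?R. size M + 1 = ?T} =
      (\<Sum>M | M \<in> ?R \<and> size M + 1 = ?T. real (arrangements M)) * real (m choose (?T - 1))"
  proof -
    have "size M = ?T - 1" if "size M + 1 = ?T" for M :: "nat set multiset" using that by simp
    then show ?thesis unfolding sum_distrib_right by (intro sum.cong) auto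
  qed
  also note sum_arrangements_second[OF assms]
  finally show ?thesis by (simp add: card_dope_matrices arrangements_generic_profile)
qed

lemma remainder_bigo:
  "(\<lambda>m. \<Sum>M | M \<in> realizable n \<and> size M + 2 \<le> triangle n. real (arrangements M) * real (m choose size M))
     \<in> O(\<lambda>m. real m powi (int (triangle n) - 2))"
proof (rule big_sum_in_bigo)
  fix M assume "M \<in> {M \<in> realizable n. size M + 2 \<le> triangle n}"
  then have M: "size M + 2 \<le> triangle n" by simp
  show "(\<lambda>m. real (arrangements M) * real (m choose size M)) \<in> O(\<lambda>m. real m powi (int (triangle n) - 2))"
  proof (rule bigoI)
    show "\<forall>\<^sub>F m in sequentially. norm (real (arrangements M) * real (m choose size M)) \<le>
        real (arrangements M) * norm (real m powi (int (triangle n) - 2))"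
      using eventually_ge_at_top[of 1]
    proof eventually_elim
      case (elim m)
      have "m choose size M \<le> m ^ size M" using binomial_fact_pow[of m "size M"]
        by (metis fact_ge_1 mult_le_mono2 nat_mult_1_right order_trans)
      also have "\<dots> \<le> m ^ (triangle n - 2)" using M elim by (intro power_increasing) auto
      finally have "real (m choose size M) \<le> real m ^ (triangle n - 2)"
        by (metis of_nat_le_iff of_nat_power)
      also have "real m ^ (triangle n - 2) = real m powi (int (triangle n) - 2)"
        using M by (simp add: of_nat_diff flip: power_int_of_nat)
      finally show ?case by (simp add: mult_left_mono abs_mult)
    qed
  qed
qed

theorem theorem1p4:
  shows "(\<forall>m n :: nat \<Rightarrow> nat.
      (\<forall>t>0. m t > 0 \<and> n t > 0) \<and>
      filterlim m at_top sequentially \<and> filterlim n at_top sequentially \<longrightarrow>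
        ((\<forall>\<^sub>F t in sequentially. real ((n t)\<^sup>2 + n t) / 2 < real (m t)) \<and>
         (\<lambda>t. real (m t)) \<in> \<Theta>[sequentially](\<lambda>t. real (n t) ^ 2) \<longrightarrow>
           (\<lambda>t. ln (real (card (dope_matrices (m t) (n t)))))
             \<sim>[sequentially]
           (\<lambda>t. ln (real (card (dope_matrices (((n t)\<^sup>2 + n t) div 2) (n t)))))) \<and>
        ((\<lambda>t. ln (real (m t))) \<in> \<omega>[sequentially](\<lambda>t. ln (real (n t))) \<longrightarrow>
           (\<lambda>t. ln (real (card (dope_matrices (m t) (n t)))))
             \<sim>[sequentially]
           (\<lambda>t. ln (real (m t choose (((n t)\<^sup>2 + n t) div 2)))))) \<and>
    (\<forall>n :: nat. n > 0 \<longrightarrow>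
        (\<exists>p :: real poly. \<forall>m>0. real (card (dope_matrices m n)) = poly p (real m)) \<and>
        (\<lambda>m. real (card (dope_matrices m n)) -
             (fact ((n\<^sup>2 + n) div 2) / (\<Prod>k=1..n. fact k) * real (m choose ((n\<^sup>2 + n) div 2)) +
              fact ((n\<^sup>2 + n) div 2) / (\<Prod>k=1..n. fact k) *
                (1 + (real n - 1) * (real n - 2) / 4) *
                real (m choose ((n\<^sup>2 + n) div 2 - 1))))
          \<in> O[sequentially](\<lambda>m. real m powi (int ((n\<^sup>2 + n) div 2) - 2)))"
  unfolding triangle_def[symmetric]
proof (intro conjI allI impI)
  fix m n :: "nat \<Rightarrow> nat"
  assume lim: "(\<forall>t>0. m t > 0 \<and> n t > 0) \<and>
      filterlim m at_top sequentially \<and> filterlim n at_top sequentially"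
  { assume "(\<forall>\<^sub>F t in sequentially. real ((n t)\<^sup>2 + n t) / 2 < real (m t)) \<and>
         (\<lambda>t. real (m t)) \<in> \<Theta>[sequentially](\<lambda>t. real (n t) ^ 2)"
    then show "(\<lambda>t. ln_dope (m t) (n t)) \<sim>[sequentially] (\<lambda>t. ln_dope (triangle (n t)) (n t))"
      using lim by (intro asymp_quadratic_range) auto }
  { assume "(\<lambda>t. ln (real (m t))) \<in> \<omega>[sequentially](\<lambda>t. ln (real (n t)))"
    moreover have "\<forall>\<^sub>F t in sequentially. 0 < m t"
      using eventually_gt_at_top[of 0] by eventually_elim (use lim in auto)
    ultimately show "(\<lambda>t. ln_dope (m t) (n t)) \<sim>[sequentially]
        (\<lambda>t. ln (real (m t choose triangle (n t))))"
      using lim by (intro asymp_superpolynomial_range) auto }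
next
  fix n :: nat assume n: "n > 0"
  show "\<exists>p :: real poly. \<forall>m>0. real (card (dope_matrices m n)) = poly p (real m)"
    using ex_poly_card_dope_matrices[of n] by blast
  show "(\<lambda>m. real (card (dope_matrices m n)) -
             (fact (triangle n) / (\<Prod>k=1..n. fact k) * real (m choose triangle n) +
              fact (triangle n) / (\<Prod>k=1..n. fact k) *
                (1 + (real n - 1) * (real n - 2) / 4) *
                real (m choose (triangle n - 1))))
          \<in> O[sequentially](\<lambda>m. real m powi (int (triangle n) - 2))"
    using remainder_bigo[of n] unfolding card_dope_matrices_two_terms[OF n] by (simp only: add_diff_cancel_left')
qed

end
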